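(* There exists a Koszul operad $\mathcal{P}$ for which there is no choice of a monomial order making the defining quadratic relations of that operad a Gröbner basis.
   Context: Work over a field $\Bbbk$ with quadratic reduced connected nonsymmetric (ns) operads. A monomial order is a total ordering of the tree monomials of the free ns operad compatible with operadic compositions; a Gröbner basis of an ideal is a generating set such that the leading monomial of every element of the ideal is divisible by a leading term of an element of the set. An operad whose relations form a quadratic Gröbner basis is Koszul; the theorem shows the converse fails. (An example is $\mathcal{U}_{\max}$ of the three-dimensional Sklyanin algebra, i.e. the ns operad with three binary generators $\alpha,\beta,\gamma$ and relations $\alpha\circ_1\beta-\beta\circ_1\alpha=\gamma\circ_1\gamma$, $\beta\circ_1\gamma-\gamma\circ_1\beta=\alpha\circ_1\alpha$, $\gamma\circ_1\alpha-\alpha\circ_1\gamma=\beta\circ_1\beta$.) *)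

theory Defs
  imports Main "HOL-Library.Function_Algebras"
begin

text \<open>A vector of a vector space with basis indexed by a type 'a is modelled
as a function 'a => 'k with finite support.\<close>

definition supp :: "('a \<Rightarrow> 'k::zero) \<Rightarrow> 'a set" where
  "supp f = {x. f x \<noteq> 0}"

definition fvec :: "('a \<Rightarrow> 'k::zero) \<Rightarrow> bool" where
  "fvec f \<longleftrightarrow> finite (supp f)"

definition lmap :: "('a \<Rightarrow> 'b) \<Rightarrow> ('a \<Rightarrow> 'k::comm_monoid_add) \<Rightarrow> 'b \<Rightarrow> 'k" where
  "lmap \<phi> f = (\<lambda>u. \<Sum>t\<in>{t. f t \<noteq> 0 \<and> \<phi> t = u}. f t)"

text \<open>Planar rooted trees; internal vertices are labelled by generators (natural
numbers). Leaf is the trivial tree (the identity of the operad).\<close>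
datatype tree = Leaf | Node nat "tree list"

primrec leaves :: "tree \<Rightarrow> nat" and leavess :: "tree list \<Rightarrow> nat" where
  "leaves Leaf = 1"
| "leaves (Node g ts) = leavess ts"
| "leavess [] = 0"
| "leavess (t # ts) = leaves t + leavess ts"

primrec weight :: "tree \<Rightarrow> nat" and weights :: "tree list \<Rightarrow> nat" where
  "weight Leaf = 0"
| "weight (Node g ts) = Suc (weights ts)"
| "weights [] = 0"
| "weights (t # ts) = weight t + weights ts"

primrec wft :: "nat set \<Rightarrow> (nat \<Rightarrow> nat) \<Rightarrow> tree \<Rightarrow> bool"
  and wfts :: "nat set \<Rightarrow> (nat \<Rightarrow> nat) \<Rightarrow> tree list \<Rightarrow> bool" where
  "wft Gs ar Leaf = True"
| "wft Gs ar (Node g ts) = (g \<in> Gs \<and> length ts = ar g \<and> wfts Gs ar ts)"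
| "wfts Gs ar [] = True"
| "wfts Gs ar (t # ts) = (wft Gs ar t \<and> wfts Gs ar ts)"

primrec subst :: "tree \<Rightarrow> tree list \<Rightarrow> tree" and substs :: "tree list \<Rightarrow> tree list \<Rightarrow> tree list" where
  "subst Leaf us = (case us of [] \<Rightarrow> Leaf | u # _ \<Rightarrow> u)"
| "subst (Node g ts) us = Node g (substs ts us)"
| "substs [] us = []"
| "substs (t # ts) us = subst t (take (leaves t) us) # substs ts (drop (leaves t) us)"

text \<open>partial composition s o_i t (leaves indexed from 0): graft t at the i-th leaf of s\<close>
definition comp :: "tree \<Rightarrow> nat \<Rightarrow> tree \<Rightarrow> tree" where
  "comp s i t = subst s (replicate i Leaf @ [t] @ replicate (leaves s - Suc i) Leaf)"

definition free_vec :: "nat set \<Rightarrow> (nat \<Rightarrow> nat) \<Rightarrow> (tree \<Rightarrow> 'k::zero) \<Rightarrow> bool" where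
  "free_vec Gs ar f \<longleftrightarrow> fvec f \<and> (\<forall>t\<in>supp f. wft Gs ar t)"

definition arity_homog :: "(tree \<Rightarrow> 'k::zero) \<Rightarrow> bool" where
  "arity_homog f \<longleftrightarrow> (\<exists>n. \<forall>t\<in>supp f. leaves t = n)"

text \<open>Data of a quadratic reduced connected ns operad F(E)/(R): generators Gs of arities
ar g \<ge> 2 (no generators of arity 0 or 1), and a space of relations R which is an
arity-graded linear subspace of the weight-2 part of the free ns operad.\<close>
definition quadratic_presentation ::
  "nat set \<Rightarrow> (nat \<Rightarrow> nat) \<Rightarrow> (tree \<Rightarrow> 'k::field) set \<Rightarrow> bool" where
  "quadratic_presentation Gs ar R \<longleftrightarrow>
     (\<forall>g\<in>Gs. 2 \<le> ar g) \<and>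
     (\<forall>r\<in>R. free_vec Gs ar r \<and> (\<forall>t\<in>supp r. weight t = 2)) \<and>
     0 \<in> R \<and> (\<forall>r\<in>R. \<forall>r'\<in>R. r + r' \<in> R) \<and> (\<forall>c. \<forall>r\<in>R. (\<lambda>t. c * r t) \<in> R) \<and>
     (\<forall>r\<in>R. \<forall>n. (\<lambda>t. if leaves t = n then r t else 0) \<in> R)"

inductive_set op_ideal :: "nat set \<Rightarrow> (nat \<Rightarrow> nat) \<Rightarrow> (tree \<Rightarrow> 'k::field) set \<Rightarrow> (tree \<Rightarrow> 'k) set"
  for Gs ar R where
  gen: "r \<in> R \<Longrightarrow> r \<in> op_ideal Gs ar R"
| zero: "0 \<in> op_ideal Gs ar R"
| add: "f \<in> op_ideal Gs ar R \<Longrightarrow> g \<in> op_ideal Gs ar R \<Longrightarrow> f + g \<in> op_ideal Gs ar R"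
| smult: "f \<in> op_ideal Gs ar R \<Longrightarrow> (\<lambda>t. c * f t) \<in> op_ideal Gs ar R"
| comp_left: "f \<in> op_ideal Gs ar R \<Longrightarrow> wft Gs ar s \<Longrightarrow> i < leaves s \<Longrightarrow>
     lmap (\<lambda>t. comp s i t) f \<in> op_ideal Gs ar R"
| comp_right: "f \<in> op_ideal Gs ar R \<Longrightarrow> wft Gs ar s \<Longrightarrow> (\<forall>t\<in>supp f. i < leaves t) \<Longrightarrow>
     lmap (\<lambda>t. comp t i s) f \<in> op_ideal Gs ar R"

definition monomial_order :: "nat set \<Rightarrow> (nat \<Rightarrow> nat) \<Rightarrow> (tree \<Rightarrow> tree \<Rightarrow> bool) \<Rightarrow> bool" where
  "monomial_order Gs ar lt \<longleftrightarrow>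
     (\<forall>s. wft Gs ar s \<longrightarrow> \<not> lt s s) \<and>
     (\<forall>s t u. wft Gs ar s \<longrightarrow> wft Gs ar t \<longrightarrow> wft Gs ar u \<longrightarrow> lt s t \<longrightarrow> lt t u \<longrightarrow> lt s u) \<and>
     (\<forall>s t. wft Gs ar s \<longrightarrow> wft Gs ar t \<longrightarrow> leaves s = leaves t \<longrightarrow> s \<noteq> t \<longrightarrow> lt s t \<or> lt t s) \<and>
     (\<forall>s s' t i. wft Gs ar s \<longrightarrow> wft Gs ar s' \<longrightarrow> wft Gs ar t \<longrightarrow> leaves s = leaves s' \<longrightarrow>
        i < leaves s \<longrightarrow> lt s s' \<longrightarrow> lt (comp s i t) (comp s' i t)) \<and>
     (\<forall>s s' t i. wft Gs ar s \<longrightarrow> wft Gs ar s' \<longrightarrow> wft Gs ar t \<longrightarrow> leaves s = leaves s' \<longrightarrow>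
        i < leaves t \<longrightarrow> lt s s' \<longrightarrow> lt (comp t i s) (comp t i s'))"

definition is_lm :: "(tree \<Rightarrow> tree \<Rightarrow> bool) \<Rightarrow> (tree \<Rightarrow> 'k::zero) \<Rightarrow> tree \<Rightarrow> bool" where
  "is_lm lt f t \<longleftrightarrow> t \<in> supp f \<and> (\<forall>u\<in>supp f. u \<noteq> t \<longrightarrow> lt u t)"

inductive divides :: "nat set \<Rightarrow> (nat \<Rightarrow> nat) \<Rightarrow> tree \<Rightarrow> tree \<Rightarrow> bool" for Gs ar where
  refl: "divides Gs ar s s"
| left: "divides Gs ar s t \<Longrightarrow> wft Gs ar u \<Longrightarrow> i < leaves u \<Longrightarrow> divides Gs ar s (comp u i t)"
| right: "divides Gs ar s t \<Longrightarrow> wft Gs ar u \<Longrightarrow> i < leaves t \<Longrightarrow> divides Gs ar s (comp t i u)"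

definition groebner_basis ::
  "nat set \<Rightarrow> (nat \<Rightarrow> nat) \<Rightarrow> (tree \<Rightarrow> tree \<Rightarrow> bool) \<Rightarrow> (tree \<Rightarrow> 'k::field) set \<Rightarrow> bool" where
  "groebner_basis Gs ar lt R \<longleftrightarrow>
     (\<forall>f\<in>op_ideal Gs ar R. f \<noteq> 0 \<and> arity_homog f \<longrightarrow>
        (\<exists>t r s. is_lm lt f t \<and> r \<in> R \<and> r \<noteq> 0 \<and> arity_homog r \<and> is_lm lt r s \<and>
                 divides Gs ar s t))"

text \<open>Basis elements of the (unreduced to P) bar construction: planar trees whose vertices
are decorated by nontrivial tree monomials; a vertex decorated by t has leaves t children.\<close>
datatype btree = BLeaf | BNode tree "btree list"

primrec nodes :: "btree \<Rightarrow> nat" and nodess :: "btree list \<Rightarrow> nat" where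
  "nodes BLeaf = 0"
| "nodes (BNode t bs) = Suc (nodess bs)"
| "nodess [] = 0"
| "nodess (b # bs) = nodes b + nodess bs"

primrec bweight :: "btree \<Rightarrow> nat" and bweights :: "btree list \<Rightarrow> nat" where
  "bweight BLeaf = 0"
| "bweight (BNode t bs) = weight t + bweights bs"
| "bweights [] = 0"
| "bweights (b # bs) = bweight b + bweights bs"

primrec wfb :: "nat set \<Rightarrow> (nat \<Rightarrow> nat) \<Rightarrow> btree \<Rightarrow> bool"
  and wfbs :: "nat set \<Rightarrow> (nat \<Rightarrow> nat) \<Rightarrow> btree list \<Rightarrow> bool" where
  "wfb Gs ar BLeaf = True"
| "wfb Gs ar (BNode t bs) = (wft Gs ar t \<and> t \<noteq> Leaf \<and> length bs = leaves t \<and> wfbs Gs ar bs)"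
| "wfbs Gs ar [] = True"
| "wfbs Gs ar (b # bs) = (wfb Gs ar b \<and> wfbs Gs ar bs)"

text \<open>Contractions of the edges from the root to its children. The vertices are ordered in
preorder (position 0 = root); contracting the edge to a vertex at position p carries the
Koszul sign (-1)^p coming from the suspensions sP.\<close>
definition root_contr :: "tree \<Rightarrow> btree list \<Rightarrow> (int \<times> btree) list" where
  "root_contr t bs = concat (map (\<lambda>j. case bs ! j of BLeaf \<Rightarrow> []
       | BNode u cs \<Rightarrow> [((-1) ^ (Suc (nodess (take j bs))),
                         BNode (comp t j u) (take j bs @ cs @ drop (Suc j) bs))]) [0..<length bs])"

primrec dl :: "btree \<Rightarrow> (int \<times> btree) list" and dls :: "btree list \<Rightarrow> (int \<times> btree list) list" where
  "dl BLeaf = []"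
| "dl (BNode t bs) = root_contr t bs @ map (\<lambda>(c, ys). (- c, BNode t ys)) (dls bs)"
| "dls [] = []"
| "dls (b # bs) = map (\<lambda>(c, x). (c, x # bs)) (dl b) @
                  map (\<lambda>(c, ys). (c * (-1) ^ nodes b, b # ys)) (dls bs)"

definition bar_d :: "(btree \<Rightarrow> 'k::field) \<Rightarrow> btree \<Rightarrow> 'k" where
  "bar_d f = (\<lambda>B'. \<Sum>B\<in>supp f. f B * (\<Sum>(c, X)\<leftarrow>dl B. if X = B' then of_int c else 0))"

fun sub_at :: "nat list \<Rightarrow> btree \<Rightarrow> btree" where
  "sub_at [] B = B"
| "sub_at (j # p) BLeaf = BLeaf"
| "sub_at (j # p) (BNode t bs) = (if j < length bs then sub_at p (bs ! j) else BLeaf)"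

fun relabel :: "nat list \<Rightarrow> tree \<Rightarrow> btree \<Rightarrow> btree" where
  "relabel p u BLeaf = BLeaf"
| "relabel [] u (BNode t bs) = BNode u bs"
| "relabel (j # p) u (BNode t bs) =
     (if j < length bs then BNode t (bs[j := relabel p u (bs ! j)]) else BNode t bs)"

text \<open>The subspace of the tensor-type space spanned by decorated trees by which one divides
to pass from decorations by tree monomials to decorations by elements of P = F(E)/(R): it is
spanned by elements in which the decoration of one vertex runs over an element of (R).\<close>
inductive_set bar_rel :: "nat set \<Rightarrow> (nat \<Rightarrow> nat) \<Rightarrow> (tree \<Rightarrow> 'k::field) set \<Rightarrow> (btree \<Rightarrow> 'k) set"
  for Gs ar R where
  zero: "0 \<in> bar_rel Gs ar R"
| add: "x \<in> bar_rel Gs ar R \<Longrightarrow> y \<in> bar_rel Gs ar R \<Longrightarrow> x + y \<in> bar_rel Gs ar R"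
| smult: "x \<in> bar_rel Gs ar R \<Longrightarrow> (\<lambda>B. c * x B) \<in> bar_rel Gs ar R"
| gen: "wfb Gs ar B \<Longrightarrow> sub_at p B = BNode t0 cs \<Longrightarrow> f \<in> op_ideal Gs ar R \<Longrightarrow>
     (\<forall>u\<in>supp f. leaves u = leaves t0) \<Longrightarrow> lmap (\<lambda>u. relabel p u B) f \<in> bar_rel Gs ar R"

definition bar_chain :: "nat set \<Rightarrow> (nat \<Rightarrow> nat) \<Rightarrow> nat \<Rightarrow> nat \<Rightarrow> (btree \<Rightarrow> 'k::field) \<Rightarrow> bool" where
  "bar_chain Gs ar k w x \<longleftrightarrow> fvec x \<and> (\<forall>B\<in>supp x. wfb Gs ar B \<and> nodes B = k \<and> bweight B = w)"

text \<open>Koszulness: the homology of the bar construction B(P) is concentrated on the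
diagonal, i.e. it vanishes in bar degree k (number of vertices) and weight w whenever k < w.
Homology is computed in the quotient by bar_rel.\<close>
definition koszul :: "nat set \<Rightarrow> (nat \<Rightarrow> nat) \<Rightarrow> (tree \<Rightarrow> 'k::field) set \<Rightarrow> bool" where
  "koszul Gs ar R \<longleftrightarrow>
     (\<forall>k w x. k < w \<longrightarrow> bar_chain Gs ar k w x \<longrightarrow> bar_d x \<in> bar_rel Gs ar R \<longrightarrow>
        (\<exists>y. bar_chain Gs ar (Suc k) w y \<and> x - bar_d y \<in> bar_rel Gs ar R))"

end

theory Submission
  imports Defs
begin

text \<open>Take three binary generators $0, 1, 2$, let all products at the second input vanish, and let the
  product $pc$ of $p$ and $c$ at the first input be independent of $p$, with $p2 = p0 + p1$. Then all
  products of weight three vanish, but $gg$ is nonzero for every generator $g$. For any monomial order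
  and its least generator $m$, the monomial $mm$ is least among the $pc$, hence it is not a leading
  monomial of a relation; so $mmm = 0$ is not detected by the quadratic relations.

  In the basis $w = 0 + 1 - 2$, $k_1 = 2 - 1$, $k_2 = 2 - 0$, only the products $w k_1$ and $w k_2$ are
  nonzero. Relative to this basis the operad is monomial, and a contracting homotopy of the
  off-diagonal part of its bar construction contracts, or cuts, the first edge of the form $w k_i$.\<close>

section \<open>Trees and finitely supported vectors\<close>

text \<open>Koszulness does not depend on the basis of the generators, but the property of having a
  quadratic Groebner basis does: relative to w, k_1, k_2 the relations are spanned by monomials, so
  the presentation has to hide that basis. Every generator must have a nonzero square, hence a
  nonzero w-coordinate and a nonzero part along k_1, k_2. With w-coordinate 1 this asks for nonzero,
  affinely independent vectors. A single k would require two distinct nonzero scalars, which the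
  field with two elements lacks; in the plane (1,0), (0,1), (1,1) work over every field, with an
  integral inverse change of basis. Computing in the quotient by \<open>bar_rel\<close> is awkward.
  Linear functionals indexed by cells replace it: they vanish on \<open>bar_rel\<close>, their
  common kernel on combinations of well-formed trees is \<open>bar_rel\<close>, and the differential
  becomes an integral operator on cells. A cycle is shown to be a boundary by prescribing the values
  of these functionals on the bounding chain.\<close>

lemma tree_list_induct [case_names Leaf Node Nil Cons]:
  assumes "P Leaf" "\<And>g ts. Q ts \<Longrightarrow> P (Node g ts)" "Q []"
    "\<And>t ts. P t \<Longrightarrow> Q ts \<Longrightarrow> Q (t # ts)"
  shows "P t" "Q ts"
  using leaves_leavess.induct[of P Q t ts] assms by blast+

lemma leavess_append [simp]: "leavess (xs @ ys) = leavess xs + leavess ys"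
  by (induction xs) auto

lemma weights_append [simp]: "weights (xs @ ys) = weights xs + weights ys"
  by (induction xs) auto

lemma wfts_append [simp]: "wfts Gs ar (xs @ ys) \<longleftrightarrow> wfts Gs ar xs \<and> wfts Gs ar ys"
  by (induction xs) auto

lemma wfts_take_drop: "wfts Gs ar xs \<Longrightarrow> wfts Gs ar (take n xs) \<and> wfts Gs ar (drop n xs)"
  by (metis append_take_drop_id wfts_append)

lemma replicate_Leaf [simp]:
  "leavess (replicate n Leaf) = n" "weights (replicate n Leaf) = 0" "wfts Gs ar (replicate n Leaf)"
  by (induction n) auto

lemma length_substs [simp]: "length (substs ts us) = length ts"
  by (induction ts arbitrary: us) auto

lemma weight_subst:
  "length us = leaves t \<Longrightarrow> weight (subst t us) = weight t + weights us"
  "length us = leavess ts \<Longrightarrow> weights (substs ts us) = weights ts + weights us"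
proof (induction t and ts arbitrary: us and us rule: tree_list_induct)
  case (Cons t ts)
  then show ?case
    by (simp flip: weights_append[of "take (leaves t) us" "drop (leaves t) us"])
qed (auto split: list.splits simp: length_Suc_conv)

lemma leaves_subst:
  "length us = leaves t \<Longrightarrow> leaves (subst t us) = leavess us"
  "length us = leavess ts \<Longrightarrow> leavess (substs ts us) = leavess us"
proof (induction t and ts arbitrary: us and us rule: tree_list_induct)
  case (Cons t ts)
  then show ?case
    by (simp flip: leavess_append[of "take (leaves t) us" "drop (leaves t) us"])
qed (auto split: list.splits simp: length_Suc_conv)

lemma wft_subst:
  "wft Gs ar t \<Longrightarrow> wfts Gs ar us \<Longrightarrow> wft Gs ar (subst t us)"
  "wfts Gs ar ts \<Longrightarrow> wfts Gs ar us \<Longrightarrow> wfts Gs ar (substs ts us)"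
  by (induction t and ts arbitrary: us and us rule: tree_list_induct)
    (auto split: list.splits simp: wfts_take_drop)

lemma subst_Leaf:
  "subst t (replicate (leaves t) Leaf) = t"
  "substs ts (replicate (leavess ts) Leaf) = ts"
  by (induction t and ts rule: tree_list_induct) auto

lemma weight_comp: "i < leaves s \<Longrightarrow> weight (comp s i t) = weight s + weight t"
  by (simp add: comp_def weight_subst)

lemma leaves_comp: "i < leaves s \<Longrightarrow> leaves (comp s i t) = leaves s - 1 + leaves t"
  by (simp add: comp_def leaves_subst)

lemma wft_comp: "wft Gs ar s \<Longrightarrow> wft Gs ar t \<Longrightarrow> wft Gs ar (comp s i t)"
  by (simp add: comp_def wft_subst)

lemma comp_Leaf_right: "i < leaves t \<Longrightarrow> comp t i Leaf = t"
proof -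
  assume "i < leaves t"
  then have "replicate i Leaf @ [Leaf] @ replicate (leaves t - Suc i) Leaf = replicate (leaves t) Leaf"
    by (intro nth_equalityI) (auto simp: nth_append nth_Cons')
  then show ?thesis
    by (simp only: comp_def subst_Leaf)
qed

lemma comp_Leaf_left [simp]: "comp Leaf 0 t = t"
  by (simp add: comp_def)

section \<open>Functionals on finitely supported vectors and on formal integer combinations\<close>

definition pair :: "('a \<Rightarrow> 'k::field) \<Rightarrow> ('a \<Rightarrow> 'k) \<Rightarrow> 'k" where
  "pair x F = (\<Sum>a\<in>supp x. x a * F a)"

lemma pair_superset: "finite S \<Longrightarrow> supp x \<subseteq> S \<Longrightarrow> pair x F = (\<Sum>a\<in>S. x a * F a)"
  unfolding pair_def by (rule sum.mono_neutral_left) (auto simp: supp_def)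

lemma supp_zero [simp]: "supp 0 = {}" "supp (\<lambda>_. 0) = {}"
  by (simp_all add: supp_def)

lemma pair_zero [simp]: "pair 0 F = 0" "pair (\<lambda>_. 0) F = 0"
  by (simp_all add: pair_def)

lemma fvec_zero [simp]: "fvec 0" "fvec (\<lambda>_. 0)"
  by (simp_all add: fvec_def)

lemma supp_add: "supp (x + y) \<subseteq> supp x \<union> supp (y :: 'a \<Rightarrow> 'k::field)"
  by (auto simp: supp_def)

lemma fvec_add: "fvec x \<Longrightarrow> fvec y \<Longrightarrow> fvec (x + y :: 'a \<Rightarrow> 'k::field)"
  unfolding fvec_def by (rule finite_subset[OF supp_add]) simp

lemma supp_diff: "supp (x - y) \<subseteq> supp x \<union> supp (y :: 'a \<Rightarrow> 'k::field)"
  by (auto simp: supp_def)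

lemma fvec_diff: "fvec x \<Longrightarrow> fvec y \<Longrightarrow> fvec (x - y :: 'a \<Rightarrow> 'k::field)"
  unfolding fvec_def by (rule finite_subset[OF supp_diff]) simp

lemma supp_scale: "supp (\<lambda>t. c * x t) \<subseteq> supp (x :: 'a \<Rightarrow> 'k::field)"
  by (auto simp: supp_def)

lemma fvec_scale: "fvec x \<Longrightarrow> fvec (\<lambda>t. c * x t :: 'k::field)"
  unfolding fvec_def by (rule finite_subset[OF supp_scale]) simp

lemma pair_add: "fvec x \<Longrightarrow> fvec y \<Longrightarrow> pair (x + y) F = pair x F + pair y F"
  using pair_superset[of "supp x \<union> supp y" x F] pair_superset[of "supp x \<union> supp y" y F]
    pair_superset[of "supp x \<union> supp y" "x + y" F]
  by (simp add: fvec_def supp_add distrib_right sum.distrib)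

lemma pair_diff: "fvec x \<Longrightarrow> fvec y \<Longrightarrow> pair (x - y) F = pair x F - pair y F"
  using pair_superset[of "supp x \<union> supp y" x F] pair_superset[of "supp x \<union> supp y" y F]
    pair_superset[of "supp x \<union> supp y" "x - y" F]
  by (simp add: fvec_def supp_diff left_diff_distrib sum_subtractf)

lemma pair_scale: "fvec x \<Longrightarrow> pair (\<lambda>t. c * x t) F = c * pair x F"
  using pair_superset[of "supp x" "\<lambda>t. c * x t" F]
  by (simp add: fvec_def supp_scale pair_def sum_distrib_left mult.assoc)

lemma pair_scale_right: "pair x (\<lambda>t. K * F t) = K * pair x F"
  by (simp add: pair_def sum_distrib_left mult_ac)

lemma pair_eq_0: "(\<And>a. x a \<noteq> 0 \<Longrightarrow> F a = 0) \<Longrightarrow> pair x F = 0"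
  unfolding pair_def by (rule sum.neutral) (auto simp: supp_def)

lemma supp_lmap: "supp (lmap \<phi> x) \<subseteq> \<phi> ` supp (x :: 'a \<Rightarrow> 'k::field)"
proof -
  have "lmap \<phi> x u = 0" if "u \<notin> \<phi> ` supp x" for u
    using that unfolding lmap_def supp_def by (intro sum.neutral) auto
  then show ?thesis by (auto simp: supp_def)
qed

lemma fvec_lmap: "fvec x \<Longrightarrow> fvec (lmap \<phi> x :: 'b \<Rightarrow> 'k::field)"
  unfolding fvec_def by (rule finite_subset[OF supp_lmap]) simp

lemma pair_lmap: "fvec x \<Longrightarrow> pair (lmap \<phi> x) F = pair x (\<lambda>t. F (\<phi> t))"
proof -
  assume "fvec x"
  then have fin: "finite (supp x)" by (simp add: fvec_def)
  have "pair (lmap \<phi> x) F = (\<Sum>u\<in>\<phi> ` supp x. lmap \<phi> x u * F u)"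
    using fin supp_lmap[of \<phi> x] by (intro pair_superset) auto
  also have "\<dots> = (\<Sum>u\<in>\<phi> ` supp x. \<Sum>t\<in>{t \<in> supp x. \<phi> t = u}. x t * F (\<phi> t))"
    by (intro sum.cong refl) (auto simp: lmap_def supp_def sum_distrib_right)
  also have "\<dots> = (\<Sum>t\<in>supp x. x t * F (\<phi> t))"
    using sum.image_gen[OF fin, of "\<lambda>t. x t * F (\<phi> t)" \<phi>] by simp
  finally show ?thesis by (simp add: pair_def)
qed

definition bvec :: "'a \<Rightarrow> 'a \<Rightarrow> 'k::field" where
  "bvec a = (\<lambda>b. if b = a then 1 else 0)"

lemma supp_bvec [simp]: "supp (bvec a) = {a}"
  by (auto simp: supp_def bvec_def)

lemma fvec_bvec [simp]: "fvec (bvec a)"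
  by (simp add: fvec_def)

lemma pair_bvec [simp]: "pair (bvec a) F = F a"
  by (simp add: pair_def) (simp add: bvec_def)

lemma pair_delta: "fvec x \<Longrightarrow> pair x (bvec a) = x a"
proof -
  assume "fvec x"
  then have "finite (supp x)" by (simp add: fvec_def)
  then have "pair x (bvec a) = (\<Sum>b\<in>supp x. if b = a then x b else 0)"
    unfolding pair_def by (intro sum.cong) (auto simp: bvec_def)
  also have "\<dots> = x a" using \<open>finite (supp x)\<close> by (auto simp: supp_def)
  finally show ?thesis .
qed

lemma lmap_bvec [simp]: "lmap \<phi> (bvec a) = (bvec (\<phi> a) :: 'b \<Rightarrow> 'k::field)"
proof
  fix u
  have S: "{t. bvec a t \<noteq> (0::'k) \<and> \<phi> t = u} = (if \<phi> a = u then {a} else {})"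
    by (auto simp: bvec_def)
  show "lmap \<phi> (bvec a) u = (bvec (\<phi> a) u :: 'k)"
    unfolding lmap_def S by (simp add: bvec_def)
qed

text \<open>Lists with integer coefficients are the format in which \<open>dl\<close> delivers the
  differential; keeping it makes the cell model independent of the field.\<close>

definition lev :: "('a \<Rightarrow> 'k::field) \<Rightarrow> (int \<times> 'a) list \<Rightarrow> 'k" where
  "lev F xs = (\<Sum>(s, e)\<leftarrow>xs. of_int s * F e)"

lemma lev_simps [simp]:
  "lev F [] = 0"
  "lev F ((s, e) # xs) = of_int s * F e + lev F xs"
  "lev F (xs @ ys) = lev F xs + lev F ys"
  by (simp_all add: lev_def)

lemma lev_map [simp]:
  "lev F (map (\<lambda>(s, e). (s, g e)) xs) = lev (\<lambda>e. F (g e)) xs"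
  "lev F (map (\<lambda>(s, e). (- s, g e)) xs) = - lev (\<lambda>e. F (g e)) xs"
  "lev F (map (\<lambda>(s, e). (s * a, g e)) xs) = of_int a * lev (\<lambda>e. F (g e)) xs"
  "lev F (map (\<lambda>(s, e). (- (s * a), g e)) xs) = - (of_int a * lev (\<lambda>e. F (g e)) xs)"
  by (induction xs) (auto simp: algebra_simps)

lemma lev_scale: "lev (\<lambda>e. K * F e) xs = K * lev F xs"
  by (induction xs) (auto simp: algebra_simps)

lemma lev_add: "lev (\<lambda>e. F e + G e) xs = lev F xs + lev G xs"
  by (induction xs) (auto simp: algebra_simps)

lemma lev_cong: "(\<And>s e. (s, e) \<in> set xs \<Longrightarrow> F e = G e) \<Longrightarrow> lev F xs = lev G xs"
  unfolding lev_def by (intro arg_cong[where f = sum_list] map_cong) auto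

lemma lev_eq_0: "(\<And>s e. (s, e) \<in> set xs \<Longrightarrow> F e = 0) \<Longrightarrow> lev F xs = 0"
  using lev_cong[of xs F "\<lambda>_. 0"] lev_scale[of 0 F xs] by simp

lemma pair_lev: "pair x (\<lambda>a. lev (\<lambda>e. F e a) xs) = lev (\<lambda>e. pair x (F e)) xs"
  by (induction xs) (auto simp: pair_def sum.distrib sum_distrib_left algebra_simps)

lemma bar_d_eq: "bar_d (x :: btree \<Rightarrow> 'k::field) B' = pair x (\<lambda>B. lev (bvec B') (dl B))"
proof -
  have "(\<Sum>(c, X)\<leftarrow>xs. if X = B' then of_int c else 0) = (lev (bvec B') xs :: 'k)" for xs
    by (induction xs) (auto simp: bvec_def)
  then show ?thesis by (simp only: bar_d_def pair_def)
qed

lemma supp_bar_d: "supp (bar_d x) \<subseteq> (\<Union>B\<in>supp x. snd ` set (dl B))"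
proof -
  have "bar_d x X = 0" if X: "X \<notin> (\<Union>B\<in>supp x. snd ` set (dl B))" for X
    unfolding bar_d_eq
  proof (intro pair_eq_0 lev_eq_0)
    fix B s e assume "x B \<noteq> 0" "(s, e) \<in> set (dl B)"
    then have "e \<in> (\<Union>B\<in>supp x. snd ` set (dl B))"
      by (force simp: supp_def)
    with X show "bvec X e = 0" by (auto simp: bvec_def)
  qed
  then show ?thesis unfolding supp_def[of "bar_d x"] by blast
qed

lemma fvec_bar_d: "fvec x \<Longrightarrow> fvec (bar_d x)"
  unfolding fvec_def by (rule finite_subset[OF supp_bar_d]) auto

text \<open>Cancellation may shrink the support of \<open>bar_d x\<close>, so both sides are summed
  over the finite set \<open>S\<close> of all contractions of trees in
  \<open>supp x\<close>.\<close>

lemma pair_bar_d: "fvec x \<Longrightarrow> pair (bar_d x) F = pair x (\<lambda>B. lev F (dl B))"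
proof -
  assume x: "fvec x"
  define S where "S = (\<Union>B\<in>supp x. snd ` set (dl B))"
  have S: "finite S" using x by (auto simp: S_def fvec_def)
  have *: "(\<Sum>X\<in>S. lev (bvec X) xs * F X) = lev F xs" if "snd ` set xs \<subseteq> S" for xs
    using that
  proof (induction xs)
    case (Cons p xs)
    obtain s e where p: "p = (s, e)" by (cases p)
    have "(\<Sum>X\<in>S. of_int s * bvec X e * F X) = (\<Sum>X\<in>S. if X = e then of_int s * F X else 0)"
      by (intro sum.cong) (auto simp: bvec_def)
    also have "\<dots> = of_int s * F e" using S Cons.prems p by simp
    finally show ?case using Cons by (simp add: p algebra_simps sum.distrib)
  qed simp
  have "pair (bar_d x) F = (\<Sum>X\<in>S. bar_d x X * F X)"
    using S supp_bar_d[of x] by (intro pair_superset) (auto simp: S_def)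
  also have "\<dots> = (\<Sum>X\<in>S. \<Sum>B\<in>supp x. x B * (lev (bvec X) (dl B) * F X))"
    by (simp add: bar_d_eq pair_def sum_distrib_right mult.assoc)
  also have "\<dots> = (\<Sum>B\<in>supp x. x B * (\<Sum>X\<in>S. lev (bvec X) (dl B) * F X))"
    by (subst sum.swap) (simp add: sum_distrib_left)
  also have "\<dots> = pair x (\<lambda>B. lev F (dl B))"
    unfolding pair_def by (intro sum.cong refl arg_cong2[of _ _ _ _ "(*)"] *) (auto simp: S_def)
  finally show ?thesis .
qed

section \<open>The monomial model\<close>

text \<open>Decorated trees over the monomial basis: \<open>V 0\<close>, \<open>V 1\<close>, \<open>V 2\<close> are vertices decorated by $w$, $k_1$,
  $k_2$, and \<open>W i\<close> is a vertex decorated by the product $w k_i$.\<close>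

datatype cell = L | V nat cell cell | W nat cell cell cell

primrec cnodes :: "cell \<Rightarrow> nat" where
  "cnodes L = 0"
| "cnodes (V l a b) = Suc (cnodes a + cnodes b)"
| "cnodes (W i a b c) = Suc (cnodes a + cnodes b + cnodes c)"

primrec cweight :: "cell \<Rightarrow> nat" where
  "cweight L = 0"
| "cweight (V l a b) = Suc (cweight a + cweight b)"
| "cweight (W i a b c) = Suc (Suc (cweight a + cweight b + cweight c))"

primrec wfc :: "cell \<Rightarrow> bool" where
  "wfc L \<longleftrightarrow> True"
| "wfc (V l a b) \<longleftrightarrow> l \<le> 2 \<and> wfc a \<and> wfc b"
| "wfc (W i a b c) \<longleftrightarrow> i \<in> {1, 2} \<and> wfc a \<and> wfc b \<and> wfc c"

text \<open>Cells index functionals on the bar construction. Accordingly \<open>expand\<close> is the transpose of the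
  differential, and \<open>contract\<close> is the transpose of the homotopy.\<close>

primrec expand :: "cell \<Rightarrow> (int \<times> cell) list" where
  "expand L = []"
| "expand (V l a b) = map (\<lambda>(s, e). (- s, V l e b)) (expand a) @
     map (\<lambda>(s, e). (s * - ((-1) ^ cnodes a), V l a e)) (expand b)"
| "expand (W i a b c) = (-1, V 0 (V i a b) c) # map (\<lambda>(s, e). (- s, W i e b c)) (expand a) @
     map (\<lambda>(s, e). (s * - ((-1) ^ cnodes a), W i a e c)) (expand b) @
     map (\<lambda>(s, e). (s * - ((-1) ^ (cnodes a + cnodes b)), W i a b e)) (expand c)"

text \<open>The edge from a vertex w to a first child k_i. No two such edges share a vertex, since
  the parent has label 0, the child has not, and only first children count. Hence each can be
  contracted or cut independently of the others.\<close>

fun joinable :: "nat \<Rightarrow> cell \<Rightarrow> bool" where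
  "joinable l (V i a b) \<longleftrightarrow> l = 0 \<and> i \<noteq> 0"
| "joinable l _ \<longleftrightarrow> False"

fun join :: "cell \<Rightarrow> cell \<Rightarrow> cell" where
  "join (V i a b) c = W i a b c"
| "join _ c = L"

text \<open>A vertex \<open>W\<close> counts as an edge w k_i already contracted. Because it is
  reducible, it stops the preorder search made by \<open>contract\<close>, which then returns the
  empty combination.\<close>

primrec reducible :: "cell \<Rightarrow> bool" where
  "reducible L \<longleftrightarrow> False"
| "reducible (V l a b) \<longleftrightarrow> joinable l a \<or> reducible a \<or> reducible b"
| "reducible (W i a b c) \<longleftrightarrow> True"

primrec contract :: "cell \<Rightarrow> (int \<times> cell) list" where
  "contract L = []"
| "contract (V l a b) =
    (if joinable l a then [(-1, join a b)]
     else if reducible a then map (\<lambda>(s, e). (- s, V l e b)) (contract a)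
     else map (\<lambda>(s, e). (s * - ((-1) ^ cnodes a), V l a e)) (contract b))"
| "contract (W i a b c) = []"

lemma joinable_iff: "joinable l a \<longleftrightarrow> l = 0 \<and> (\<exists>i b c. a = V i b c \<and> i \<noteq> 0)"
  by (cases a) auto

text \<open>Expansion keeps the root label of a \<open>V\<close>, and a root \<open>W\<close> splits
  into a root with label 0, which is never the second factor of w k_i. So no new edge w k_i appears
  above the expanded subtree.\<close>

lemma expand_joinable: "(s, e) \<in> set (expand a) \<Longrightarrow> joinable l e \<longleftrightarrow> joinable l a"
  by (cases a) auto

lemma expand_reducible: "(s, e) \<in> set (expand a) \<Longrightarrow> wfc a \<Longrightarrow> reducible e"
  by (induction a arbitrary: s e) (auto simp: expand_joinable)

lemma irreducible_expand: "\<not> reducible a \<Longrightarrow> expand a = []"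
  by (induction a) auto

text \<open>Without \<open>W\<close> every vertex has weight one, so the cells not reached by the
  homotopy lie on the diagonal.\<close>

lemma irreducible_cnodes: "\<not> reducible a \<Longrightarrow> cnodes a = cweight a"
  by (induction a) auto

lemma expand_invariants:
  "(s, e) \<in> set (expand a) \<Longrightarrow> cnodes e = Suc (cnodes a) \<and> cweight e = cweight a \<and> (wfc a \<longrightarrow> wfc e)"
  by (induction a arbitrary: s e) fastforce+

lemma contract_invariants:
  "(s, e) \<in> set (contract a) \<Longrightarrow> cnodes a = Suc (cnodes e) \<and> cweight e = cweight a \<and> (wfc a \<longrightarrow> wfc e)"
proof (induction a arbitrary: s e)
  case (V l a b)
  then show ?case by (fastforce split: if_splits simp: joinable_iff)
qed auto

lemma lev_swap: "lev (\<lambda>x. lev (\<lambda>y. F x y) ys) xs = lev (\<lambda>y. lev (\<lambda>x. F x y) xs) ys"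
  by (induction xs) (auto simp: lev_add lev_scale lev_eq_0)

lemma lev_uminus: "lev (\<lambda>e. - F e) xs = - lev F xs"
  using lev_scale[of "-1" F xs] by simp

lemma lev_diff: "lev (\<lambda>e. F e - G e) xs = lev F xs - lev G xs"
  using lev_add[of F "\<lambda>e. - G e" xs] by (simp add: lev_uminus)

lemma lev_expand_V: "lev F (expand (V l a b)) =
    - lev (\<lambda>e. F (V l e b)) (expand a) - (-1) ^ cnodes a * lev (\<lambda>e. F (V l a e)) (expand b)"
  by simp

lemma lev_expand_W: "lev F (expand (W i a b c)) = - F (V 0 (V i a b) c)
    - lev (\<lambda>e. F (W i e b c)) (expand a) - (-1) ^ cnodes a * lev (\<lambda>e. F (W i a e c)) (expand b)
    - (-1) ^ (cnodes a + cnodes b) * lev (\<lambda>e. F (W i a b e)) (expand c)"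
  by simp

text \<open>At the first edge w k_i, cutting and contracting are inverse to each other. All other
  expansions happen elsewhere and anticommute with \<open>contract\<close>, so they cancel.\<close>

lemma homotopy:
  "wfc c \<Longrightarrow> reducible c \<Longrightarrow>
    lev (\<lambda>e. lev F (contract e)) (expand c) + lev (\<lambda>e. lev F (expand e)) (contract c) = F c"
proof (induction c arbitrary: F)
  case (V l a b)
  consider "joinable l a" | "\<not> joinable l a" "reducible a" | "\<not> joinable l a" "\<not> reducible a"
    by blast
  then show ?case
  proof cases
    case 1
    then obtain i a1 a2 where l: "l = 0" and a: "a = V i a1 a2" and i: "i \<noteq> 0"
      by (auto simp: joinable_iff)
    show ?thesis
      unfolding lev_expand_V l a lev_expand_V
      using i by (simp add: lev_uminus lev_expand_W algebra_simps del: expand.simps)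
  next
    case 2
    \<comment> \<open>Expanding in \<open>a\<close> keeps \<open>a\<close> reducible and creates no
      edge at the root, so \<open>contract\<close> takes the same branch.\<close>
    have 3: "lev (\<lambda>e. lev F (contract (V l e b))) (expand a)
        = lev (\<lambda>e. - lev (\<lambda>e'. F (V l e' b)) (contract e)) (expand a)"
      using 2 V.prems expand_joinable expand_reducible by (intro lev_cong) simp
    \<comment> \<open>\<open>contract\<close> removes one node of \<open>a\<close>, which flips the
      sign of the terms coming from \<open>expand b\<close>; this makes them cancel.\<close>
    have 4: "lev (\<lambda>e. lev F (expand (V l e b))) (contract a)
        = lev (\<lambda>e. (-1) ^ cnodes a * lev (\<lambda>e'. F (V l e e')) (expand b)
            - lev (\<lambda>e'. F (V l e' b)) (expand e)) (contract a)"
      by (intro lev_cong, drule contract_invariants) (simp only: lev_expand_V, simp)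
    have 5: "contract (V l a b') = map (\<lambda>(s, e). (- s, V l e b')) (contract a)" for b'
      using 2 by simp
    have "lev (\<lambda>e. lev (\<lambda>a. F (V l a b)) (contract e)) (expand a)
        + lev (\<lambda>e. lev (\<lambda>a. F (V l a b)) (expand e)) (contract a) = F (V l a b)"
      using V 2 by simp
    then show ?thesis
      unfolding lev_expand_V 3 unfolding 5 lev_map 4
      by (simp only: lev_uminus lev_diff lev_scale lev_swap[of _ "expand b"]) simp
  next
    case 3
    then have b: "reducible b" using V.prems by simp
    then show ?thesis
      unfolding lev_expand_V
      using 3 V.prems V.IH(2)[of "\<lambda>e. F (V l a e)"]
      by (simp add: irreducible_expand lev_expand_V lev_scale lev_uminus algebra_simps del: expand.simps)
  qed
next
  case (W i a b c)
  \<comment> \<open>Only the cut edge can be contracted again; the other expansions still have a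
    root \<open>W\<close>, where \<open>contract\<close> is empty.\<close>
  then have "i \<noteq> 0" by auto
  then show ?case
    unfolding lev_expand_W by (simp add: lev_eq_0)
qed auto

section \<open>The operad\<close>

definition gens :: "nat set" where "gens = {0, 1, 2}"
abbreviation two :: "nat \<Rightarrow> nat" where "two \<equiv> \<lambda>_. 2"
abbreviation corolla :: "nat \<Rightarrow> tree" where "corolla g \<equiv> Node g [Leaf, Leaf]"
abbreviation comb :: "nat \<Rightarrow> nat \<Rightarrow> tree" where "comb p c \<equiv> Node p [corolla c, Leaf]"

lemma gens_mem [simp]: "0 \<in> gens" "1 \<in> gens" "Suc 0 \<in> gens" "2 \<in> gens"
  by (simp_all add: gens_def)

lemma length_2_iff: "length xs = 2 \<longleftrightarrow> (\<exists>x y. xs = [x, y])"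
  by (auto simp: length_Suc_conv numeral_2_eq_2)

text \<open>The coordinates of the generator $g$ in the basis $w, k_1, k_2$: the generators $0, 1, 2$ are
  $w + k_1$, $w + k_2$, $w + k_1 + k_2$.\<close>

definition coord :: "nat \<Rightarrow> nat \<Rightarrow> 'k::field" where
  "coord l g = (if l = 0 \<or> g = 2 \<or> Suc g = l then 1 else 0)"

text \<open>The functionals dual to w, k_1, k_2, extended by zero to all other monomials.\<close>

definition gen_form :: "nat \<Rightarrow> tree \<Rightarrow> 'k::field" where
  "gen_form l t = (case t of Node g [Leaf, Leaf] \<Rightarrow> coord l g | _ \<Rightarrow> 0)"

text \<open>The functionals dual to w k_1 and w k_2. The label \<open>p\<close> has no influence
  because every generator has w-coordinate 1.\<close>

definition prod_form :: "nat \<Rightarrow> tree \<Rightarrow> 'k::field" where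
  "prod_form i t = (case t of Node p [Node c [Leaf, Leaf], Leaf] \<Rightarrow> coord i c | _ \<Rightarrow> 0)"

text \<open>A joint kernel instead of a spanning set: membership is a test of two functionals, and
  monomials with a nontrivial second child pass it at once.\<close>

definition rels :: "(tree \<Rightarrow> 'k::field) set" where
  "rels = {r. free_vec gens two r \<and> (\<forall>t\<in>supp r. weight t = 2) \<and>
     (\<forall>i\<in>{1, 2}. pair r (prod_form i) = 0)}"

abbreviation ideal :: "(tree \<Rightarrow> 'k::field) set" where
  "ideal \<equiv> op_ideal gens two rels"

lemma gen_form_eq_0: "weight t \<noteq> 1 \<Longrightarrow> gen_form l t = 0"
  by (auto simp: gen_form_def split: tree.splits list.splits)

lemma prod_form_eq_0: "weight t \<noteq> 2 \<Longrightarrow> prod_form i t = 0"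
  by (auto simp: prod_form_def split: tree.splits list.splits)

lemma form_simps [simp]:
  "gen_form l (corolla g) = coord l g"
  "prod_form i (comb p c) = coord i c"
  "prod_form i (Node p [t, Node c ts]) = 0"
  by (auto simp: gen_form_def prod_form_def split: tree.splits list.splits)

lemma leaves_binary:
  "wft gens two t \<Longrightarrow> leaves t = Suc (weight t)"
  "wfts gens two ts \<Longrightarrow> leavess ts = weights ts + length ts"
  by (induction t and ts rule: tree_list_induct) auto

lemma weight_1_cases:
  assumes "wft gens two t" "weight t = 1"
  obtains g where "g \<in> gens" "t = corolla g"
proof -
  have Leaf: "u = Leaf" if "weight u = 0" for u
    using that by (cases u) auto
  show ?thesis
    using assms that
    by (cases t) (auto simp: length_2_iff dest!: Leaf)
qed

lemma weight_2_cases: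
  assumes "wft gens two t" "weight t = 2"
  obtains p c where "p \<in> gens" "c \<in> gens" "t = comb p c"
  | p c where "p \<in> gens" "c \<in> gens" "t = Node p [Leaf, corolla c]"
proof -
  obtain p a b where t: "t = Node p [a, b]" "p \<in> gens"
    using assms by (cases t) (auto simp: length_2_iff)
  have Leaf: "u = Leaf" if "weight u = 0" for u
    using that by (cases u) auto
  have wf: "wft gens two a" "wft gens two b" using assms t by auto
  have "weight a = 1 \<and> b = Leaf \<or> weight b = 1 \<and> a = Leaf"
    using assms t Leaf[of a] Leaf[of b] by (cases "weight a") auto
  then show ?thesis
  proof (elim disjE conjE)
    assume "weight a = 1" "b = Leaf"
    then show ?thesis using that(1) t weight_1_cases[OF wf(1)] by blast
  next
    assume "weight b = 1" "a = Leaf"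
    then show ?thesis using that(2) t weight_1_cases[OF wf(2)] by blast
  qed
qed

lemma quadratic_presentation_rels: "quadratic_presentation gens two (rels :: (tree \<Rightarrow> 'k::field) set)"
  unfolding quadratic_presentation_def
proof (intro conjI ballI allI)
  fix r :: "tree \<Rightarrow> 'k" and n assume r: "r \<in> rels"
  \<comment> \<open>All generators are binary, so weight 2 forces arity 3 and the arity grading of
    \<open>rels\<close> has a single component.\<close>
  have "(\<lambda>t. if leaves t = n then r t else 0) = (if n = 3 then r else 0)"
  proof
    fix t
    have "leaves t = 3" if "r t \<noteq> 0"
      using that r leaves_binary(1)[of t] by (auto simp: rels_def free_vec_def supp_def)
    then show "(if leaves t = n then r t else 0) = (if n = 3 then r else 0) t"
      by auto
  qed
  moreover have "(0 :: tree \<Rightarrow> 'k) \<in> rels" by (simp add: rels_def free_vec_def)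
  ultimately show "(\<lambda>t. if leaves t = n then r t else 0) \<in> rels" using r by simp
next
  fix r r' :: "tree \<Rightarrow> 'k" assume "r \<in> rels" "r' \<in> rels"
  then show "r + r' \<in> rels"
    using supp_add[of r r'] by (auto simp: rels_def free_vec_def fvec_add pair_add)
next
  fix c and r :: "tree \<Rightarrow> 'k" assume "r \<in> rels"
  then show "(\<lambda>t. c * r t) \<in> rels"
    using supp_scale[of c r] by (auto simp: rels_def free_vec_def fvec_scale pair_scale)
qed (auto simp: rels_def free_vec_def)

text \<open>Composing with a nontrivial tree raises the weight to at least 3, where
  \<open>prod_form\<close> vanishes, and composing with \<open>Leaf\<close> changes nothing. So all
  five forms descend to the quotient operad.\<close>

lemma ideal_props:
  assumes "f \<in> ideal"
  shows "fvec f \<and> (\<forall>t\<in>supp f. 2 \<le> weight t \<and> wft gens two t) \<and> (\<forall>i\<in>{1, 2}. pair f (prod_form i) = 0)"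
  using assms
proof induction
  case (gen r)
  then show ?case by (auto simp: rels_def free_vec_def)
next
  case (add f g)
  then show ?case
    using supp_add[of f g] fvec_add[of f g] pair_add[of f g] unfolding plus_fun_def by auto
next
  case (smult f c)
  then show ?case using supp_scale[of c f] by (auto simp: fvec_scale pair_scale)
next
  case (comp_left f s i)
  have "pair f (\<lambda>t. prod_form j (comp s i t)) = 0" if "j \<in> {1, 2}" for j
  proof (cases "s = Leaf")
    case True
    then show ?thesis using comp_left that by auto
  next
    case False
    then have "0 < weight s" by (cases s) auto
    then show ?thesis
      using comp_left by (intro pair_eq_0 prod_form_eq_0) (auto simp: weight_comp supp_def)
  qed
  then show ?case
    using comp_left supp_lmap[of "comp s i" f]
    by (fastforce simp: fvec_lmap pair_lmap weight_comp wft_comp)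
next
  case (comp_right f s i)
  have "pair f (\<lambda>t. prod_form j (comp t i s)) = 0" if "j \<in> {1, 2}" for j
  proof (cases "s = Leaf")
    case True
    have "pair f (\<lambda>t. prod_form j (comp t i s)) = pair f (prod_form j)"
      unfolding pair_def using comp_right True by (intro sum.cong) (auto simp: comp_Leaf_right)
    then show ?thesis using comp_right that by auto
  next
    case False
    then have "0 < weight s" by (cases s) auto
    then show ?thesis
      using comp_right by (intro pair_eq_0 prod_form_eq_0) (fastforce simp: weight_comp supp_def)
  qed
  then show ?case
    using comp_right supp_lmap[of "\<lambda>t. comp t i s" f]
    by (fastforce simp: fvec_lmap pair_lmap weight_comp wft_comp)
qed auto

section \<open>Explicit elements of the ideal and vanishing from weight three on\<close>

lemma ideal_diff: "f \<in> ideal \<Longrightarrow> g \<in> ideal \<Longrightarrow> f - g \<in> ideal"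
  using op_ideal.add[OF _ op_ideal.smult[of g gens two rels "-1"], of f]
  by (simp add: fun_eq_iff[symmetric] fun_diff_def plus_fun_def)

lemma rels_bvec_diff:
  assumes "p \<in> gens" "p' \<in> gens" "c \<in> gens"
  shows "bvec (comb p c) - bvec (comb p' c) \<in> ideal"
  using assms supp_diff[of "bvec (comb p c)" "bvec (comb p' c)"]
  by (intro op_ideal.gen) (auto simp: rels_def free_vec_def fvec_diff pair_diff)

lemma rels_bvec_sum:
  assumes "p \<in> gens"
  shows "bvec (comb p 2) - (bvec (comb p 0) + bvec (comb p 1)) \<in> (ideal :: (tree \<Rightarrow> 'k::field) set)" (is "?f \<in> _")
proof -
  have "supp ?f \<subseteq> {comb p 2, comb p 0, comb p 1}"
    using supp_diff[of "bvec (comb p 2)" "bvec (comb p 0) + bvec (comb p 1)"]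
      supp_add[of "bvec (comb p 0)" "bvec (comb p 1)"] by auto
  then have "\<forall>t\<in>supp ?f. wft gens two t \<and> weight t = 2"
    using assms by auto
  moreover have "coord i 2 = coord i 0 + (coord i 1 :: 'k)" if "i \<in> {1, 2}" for i
    using that by (auto simp: coord_def)
  ultimately show ?thesis
    by (intro op_ideal.gen) (simp add: rels_def free_vec_def fvec_diff fvec_add pair_add pair_diff)
qed

text \<open>Expressing \<open>lmap\<close> through \<open>pair\<close> reduces its additivity to
  that of \<open>pair\<close>.\<close>

lemma lmap_eq: "fvec x \<Longrightarrow> lmap \<phi> x = (\<lambda>u. pair x (\<lambda>t. bvec u (\<phi> t)))"
  using pair_delta[OF fvec_lmap, of x \<phi>] by (simp add: fun_eq_iff pair_lmap)

lemma lmap_add: "fvec x \<Longrightarrow> fvec y \<Longrightarrow> lmap \<phi> (x + y) = lmap \<phi> x + lmap \<phi> (y :: 'a \<Rightarrow> 'k::field)"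
  by (simp add: lmap_eq fvec_add pair_add fun_eq_iff)

lemma lmap_diff: "fvec x \<Longrightarrow> fvec y \<Longrightarrow> lmap \<phi> (x - y) = lmap \<phi> x - lmap \<phi> (y :: 'a \<Rightarrow> 'k::field)"
  by (simp add: lmap_eq fvec_diff pair_diff fun_eq_iff)

lemma ideal_comp_left:
  fixes R :: "(tree \<Rightarrow> 'k::field) set"
  shows "bvec t \<in> op_ideal Gs ar R \<Longrightarrow> wft Gs ar s \<Longrightarrow> i < leaves s \<Longrightarrow> bvec (comp s i t) \<in> op_ideal Gs ar R"
  using op_ideal.comp_left[of "bvec t" Gs ar R s i] by simp

lemma ideal_comp_right:
  fixes R :: "(tree \<Rightarrow> 'k::field) set"
  shows "bvec t \<in> op_ideal Gs ar R \<Longrightarrow> wft Gs ar s \<Longrightarrow> i < leaves t \<Longrightarrow> bvec (comp t i s) \<in> op_ideal Gs ar R"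
  using op_ideal.comp_right[of "bvec t" Gs ar R s i] by simp

lemma ideal_child:
  assumes "bvec t \<in> (ideal :: (tree \<Rightarrow> 'k::field) set)" "g \<in> gens" "wft gens two s"
  shows "bvec (Node g [t, s]) \<in> (ideal :: (tree \<Rightarrow> 'k) set)"
proof -
  have "comp (Node g [Leaf, s]) 0 t = Node g [t, s]"
    by (simp add: comp_def subst_Leaf)
  then show ?thesis using ideal_comp_left[of t gens two rels "Node g [Leaf, s]" 0] assms by auto
qed

lemma ideal_second_child:
  assumes "wft gens two (Node p [a, Node c [b, b']])"
  shows "bvec (Node p [a, Node c [b, b']]) \<in> ideal"
proof -
  have "bvec (Node p [Leaf, corolla c]) \<in> ideal"
    using assms by (intro op_ideal.gen) (auto simp: rels_def free_vec_def)
  \<comment> \<open>Grafting from the last leaf to the first keeps the positions of the leaves still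
    to be used.\<close>
  then have "bvec (comp (comp (comp (Node p [Leaf, corolla c]) 2 b') 1 b) 0 a) \<in> ideal"
    using assms by (intro ideal_comp_right) (auto simp: leaves_comp)
  moreover have "comp (Node p [Leaf, corolla c]) 2 b' = Node p [Leaf, Node c [Leaf, b']]"
    by (simp add: comp_def eval_nat_numeral)
  moreover have "comp (Node p [Leaf, Node c [Leaf, b']]) 1 b = Node p [Leaf, Node c [b, b']]"
    by (simp add: comp_def subst_Leaf)
  moreover have "comp (Node p [Leaf, Node c [b, b']]) 0 a = Node p [a, Node c [b, b']]"
    by (simp add: comp_def subst_Leaf)
  ultimately show ?thesis by simp
qed

text \<open>With $pc$ for the product of $p$ and $c$ at the first input, $pc$ does not depend on $p$, hence
  $pcd = p0d = p1d = p2d$, while $p2 = p0 + p1$.\<close>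

lemma ideal_left_comb:
  assumes g: "p \<in> gens" "c \<in> gens" "d \<in> gens"
  shows "bvec (Node p [comb c d, Leaf]) \<in> ideal"
proof -
  let ?T = "\<lambda>c. bvec (Node p [comb c d, Leaf])"
  have comp1: "comp (corolla p) 0 t = Node p [t, Leaf]" for t
    by (simp add: comp_def)
  have comp2: "comp (comb p e) 0 (corolla d) = Node p [comb e d, Leaf]" for e
    by (simp add: comp_def eval_nat_numeral)
  have 1: "?T e - ?T e' \<in> ideal" if "e \<in> gens" "e' \<in> gens" for e e'
    using op_ideal.comp_left[OF rels_bvec_diff[OF that g(3)], of "corolla p" 0] g
    by (simp add: lmap_diff comp1)
  have "\<forall>t\<in>supp (bvec (comb p 2) - (bvec (comb p 0) + bvec (comb p 1))). 0 < leaves t"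
    using ideal_props[OF rels_bvec_sum[OF g(1)]] leaves_binary by auto
  from op_ideal.comp_right[OF rels_bvec_sum[OF g(1)] _ this, of "corolla d"] g
  have 2: "?T 2 - (?T 0 + ?T 1) \<in> ideal"
    by (simp only: lmap_diff lmap_add fvec_add fvec_bvec lmap_bvec comp2) simp
  have "(?T c - ?T 0) + ((?T 2 - ?T 1) - (?T 2 - (?T 0 + ?T 1))) \<in> ideal"
    using g by (intro op_ideal.add ideal_diff 1 2) auto
  then show ?thesis by simp
qed

text \<open>A nontrivial second child puts a tree into the ideal at once, so the induction descends
  along first children only; what remains at weight 3 is a left comb.\<close>

lemma ideal_weight_3: "wft gens two t \<Longrightarrow> 3 \<le> weight t \<Longrightarrow> bvec t \<in> ideal"
proof (induction "weight t" arbitrary: t rule: less_induct)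
  case less
  then obtain p a b where t: "t = Node p [a, b]"
    by (cases t) (auto simp: length_2_iff)
  show ?case
  proof (cases b)
    case (Node c bs)
    then show ?thesis
      using less.prems by (auto simp: t length_2_iff intro: ideal_second_child)
  next
    case Leaf
    show ?thesis
    proof (cases "3 \<le> weight a")
      case True
      then show ?thesis using less t Leaf by (auto intro: ideal_child)
    next
      case False
      then have "weight a = 2" using less.prems t Leaf by auto
      then obtain c x y where a: "a = Node c [x, y]"
        using less.prems t by (cases a) (auto simp: length_2_iff)
      show ?thesis
      proof (cases y)
        case (Node d ys)
        then have "bvec a \<in> ideal"
          using less.prems by (auto simp: t a length_2_iff intro: ideal_second_child)
        then show ?thesis using less.prems t Leaf by (auto intro: ideal_child)
      next
        case y: Leaf
        then have "weight x = 1" "wft gens two x"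
          using \<open>weight a = 2\<close> less.prems t a by auto
        then obtain d where "d \<in> gens" "x = corolla d"
          using weight_1_cases by blast
        then show ?thesis
          using less.prems by (auto simp: t Leaf a y intro: ideal_left_comb)
      qed
    qed
  qed
qed

section \<open>Comparison of the bar construction with the monomial model\<close>

definition vec :: "(int \<times> 'a) list \<Rightarrow> 'a \<Rightarrow> 'k::field" where
  "vec xs = (\<lambda>b. lev (bvec b) xs)"

lemma supp_vec: "supp (vec xs) \<subseteq> snd ` set xs"
proof -
  have "vec xs b = 0" if b: "b \<notin> snd ` set xs" for b
    unfolding vec_def
  proof (rule lev_eq_0)
    fix s e assume "(s, e) \<in> set xs"
    with b show "bvec b e = 0" by (force simp: bvec_def)
  qed
  then show ?thesis unfolding supp_def[of "vec xs"] by blast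
qed

lemma fvec_vec [simp]: "fvec (vec xs)"
  unfolding fvec_def by (rule finite_subset[OF supp_vec]) simp

lemma vec_simps [simp]:
  "vec [] = 0"
  "vec ((s, a) # xs) = (\<lambda>b. of_int s * bvec a b) + vec xs"
  by (auto simp: vec_def fun_eq_iff bvec_def)

lemma pair_vec: "pair (vec xs) F = lev F xs"
  by (induction xs) (auto simp: pair_add pair_scale fvec_scale)

text \<open>Monomials representing a basis of the operad in positive weight; \<open>comb 0 0\<close>
  and \<open>comb 0 1\<close> represent w k_1 and w k_2.\<close>

definition normal_tree :: "tree \<Rightarrow> bool" where
  "normal_tree t \<longleftrightarrow> (\<exists>g\<in>gens. t = corolla g) \<or> t = comb 0 0 \<or> t = comb 0 1"

text \<open>In weight 2 the root label can be changed to 0, and an upper label 2 splits into 0 and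
  1; higher weights vanish. The number of leaves is recorded because \<open>bar_rel\<close>
  exchanges decorations only within one arity.\<close>

lemma normalise_tree:
  assumes t: "wft gens two t" "t \<noteq> Leaf"
  shows "\<exists>xs. (\<forall>(s, u)\<in>set xs. normal_tree u \<and> leaves u = leaves t) \<and>
    bvec t - vec xs \<in> (ideal :: (tree \<Rightarrow> 'k::field) set)"
proof -
  have "weight t \<noteq> 0" using t by (cases t) auto
  then consider "weight t = 1" | "weight t = 2" | "3 \<le> weight t" by linarith
  then show ?thesis
  proof cases
    case 1
    then obtain g where "g \<in> gens" "t = corolla g" using t weight_1_cases by blast
    then show ?thesis
      by (intro exI[of _ "[(1, t)]"]) (auto simp: normal_tree_def op_ideal.zero)
  next
    case 2
    with t(1) show ?thesis
    proof (cases rule: weight_2_cases)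
      case (1 p c)
      define b where "b = (\<lambda>p c. bvec (comb p c) :: tree \<Rightarrow> 'k)"
      have d: "b p c - b 0 c \<in> ideal"
        using rels_bvec_diff[OF 1(1) _ 1(2), of 0] by (simp add: b_def)
      consider "c = 0" | "c = 1" | "c = 2" using 1 by (auto simp: gens_def)
      then show ?thesis
      proof cases
        assume c: "c = 0"
        show ?thesis
          using d 1 c by (intro exI[of _ "[(1, comb 0 0)]"]) (auto simp: normal_tree_def b_def)
      next
        assume c: "c = 1"
        show ?thesis
          using d 1 c by (intro exI[of _ "[(1, comb 0 1)]"]) (auto simp: normal_tree_def b_def)
      next
        assume c: "c = 2"
        have "(b p c - b 0 c) + (b 0 2 - (b 0 0 + b 0 1)) \<in> ideal"
          using d rels_bvec_sum[of 0] by (intro op_ideal.add) (auto simp: b_def)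
        moreover have "(b p c - b 0 c) + (b 0 2 - (b 0 0 + b 0 1)) = b p c - (b 0 0 + b 0 1)"
          using c by simp
        ultimately have "bvec t - (b 0 0 + b 0 1) \<in> ideal"
          using 1 by (simp only: b_def)
        then show ?thesis
          using 1 by (intro exI[of _ "[(1, comb 0 0), (1, comb 0 1)]"]) (auto simp: normal_tree_def b_def)
      qed
    next
      case (2 p c)
      then show ?thesis
        using ideal_second_child[of p Leaf c Leaf Leaf] by (intro exI[of _ "[]"]) auto
    qed
  next
    case 3
    then show ?thesis
      using ideal_weight_3[OF t(1)] by (intro exI[of _ "[]"]) auto
  qed
qed

section \<open>Functionals on decorated trees indexed by cells\<close>

text \<open>The tensor product of the dual basis along the shape of the cell: a coordinate function
  of the bar construction in the monomial basis.\<close>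

primrec val :: "cell \<Rightarrow> btree \<Rightarrow> 'k::field" where
  "val L B = (if B = BLeaf then 1 else 0)"
| "val (V l a b) B =
    (case B of BNode t [x, y] \<Rightarrow> gen_form l t * val a x * val b y | _ \<Rightarrow> 0)"
| "val (W i a b c) B =
    (case B of BNode t [x, y, z] \<Rightarrow> prod_form i t * val a x * val b y * val c z | _ \<Rightarrow> 0)"

abbreviation wfb2 :: "btree \<Rightarrow> bool" where "wfb2 \<equiv> wfb gens two"

lemma val_BLeaf: "val c BLeaf = (if c = L then 1 else 0)"
  by (cases c) auto

lemma val_BNode_eq_0:
  "length bs \<noteq> 2 \<Longrightarrow> val (V l a b) (BNode t bs) = 0"
  "length bs \<noteq> 3 \<Longrightarrow> val (W i a b c) (BNode t bs) = 0"
  by (auto split: list.splits)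

lemma length_3_iff: "length xs = 3 \<longleftrightarrow> (\<exists>x y z. xs = [x, y, z])"
  by (auto simp: length_Suc_conv numeral_3_eq_3)

text \<open>This lets Koszul signs be read off the cell instead of the tree, and confines the values
  of a chain to cells of its own bidegree.\<close>

lemma val_degrees: "val c B \<noteq> 0 \<Longrightarrow> nodes B = cnodes c \<and> bweight B = cweight c"
proof (induction c arbitrary: B)
  case (V l a b)
  then obtain t x y where "B = BNode t [x, y]" "gen_form l t \<noteq> (0::'a)" "val a x \<noteq> (0::'a)" "val b y \<noteq> (0::'a)"
    by (auto split: btree.splits list.splits)
  moreover from this have "weight t = 1" using gen_form_eq_0 by blast
  ultimately show ?case using V.IH by auto
next
  case (W i a b c)
  then obtain t x y z where "B = BNode t [x, y, z]" "prod_form i t \<noteq> (0::'a)"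
    "val a x \<noteq> (0::'a)" "val b y \<noteq> (0::'a)" "val c z \<noteq> (0::'a)"
    by (auto split: btree.splits list.splits)
  moreover from this have "weight t = 2" using prod_form_eq_0 by blast
  ultimately show ?case using W.IH by auto
qed (auto split: if_splits)

text \<open>\<open>val c\<close> is multilinear in the decorations: with all but one of them fixed,
  a multiple of a single form at that vertex remains. If the shapes of \<open>c\<close> and
  \<open>B\<close> disagree, the factor \<open>K\<close> is 0 and the form is arbitrary.\<close>

lemma val_relabel:
  assumes "wfc c" "sub_at p B = BNode t0 cs"
  shows "\<exists>K F. (F \<in> range gen_form \<or> F \<in> prod_form ` {1, 2}) \<and>
    (\<forall>u. val c (relabel p u B) = (K * F u :: 'k::field))"
  using assms
proof (induction c arbitrary: p B)
  case L
  have "relabel p u B \<noteq> BLeaf" for u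
    using L by (cases p; cases B) auto
  then show ?case by (intro exI[of _ 0] exI[of _ "gen_form 0"]) auto
next
  case (V l a b)
  show ?case
  proof (cases B)
    case BLeaf
    then show ?thesis using V.prems by (cases p) auto
  next
    case (BNode t bs)
    show ?thesis
    proof (cases "length bs = 2")
      case False
      then have "val (V l a b) (relabel p u B) = (0::'k)" for u
        unfolding BNode by (cases p) (auto simp: val_BNode_eq_0 simp del: val.simps)
      then show ?thesis by (intro exI[of _ 0] exI[of _ "gen_form 0"]) auto
    next
      case True
      then obtain x y where bs: "bs = [x, y]" by (auto simp: length_2_iff)
      consider "p = []" | p' where "p = 0 # p'" "sub_at p' x = BNode t0 cs"
        | p' where "p = 1 # p'" "sub_at p' y = BNode t0 cs"
        using V.prems unfolding BNode bs
        by (cases p) (auto simp: less_Suc_eq nth_Cons' split: if_splits)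
      then show ?thesis
      proof cases
        case 1
        then show ?thesis
          unfolding BNode bs
          by (intro exI[of _ "val a x * val b y"] exI[of _ "gen_form l"]) auto
      next
        case (2 p')
        then obtain K F where "F \<in> range gen_form \<or> F \<in> prod_form ` {1, 2}"
          "\<And>u. val a (relabel p' u x) = (K * F u :: 'k)"
          using V.IH(1) V.prems by (meson wfc.simps)
        then show ?thesis
          unfolding BNode bs 2
          by (intro exI[of _ "gen_form l t * K * val b y"] exI[of _ F]) auto
      next
        case (3 p')
        then obtain K F where "F \<in> range gen_form \<or> F \<in> prod_form ` {1, 2}"
          "\<And>u. val b (relabel p' u y) = (K * F u :: 'k)"
          using V.IH(2) V.prems by (meson wfc.simps)
        then show ?thesis
          unfolding BNode bs 3
          by (intro exI[of _ "gen_form l t * val a x * K"] exI[of _ F]) auto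
      qed
    qed
  qed
next
  case (W i a b c)
  show ?case
  proof (cases B)
    case BLeaf
    then show ?thesis using W.prems by (cases p) auto
  next
    case (BNode t bs)
    show ?thesis
    proof (cases "length bs = 3")
      case False
      then have "val (W i a b c) (relabel p u B) = (0::'k)" for u
        unfolding BNode by (cases p) (auto simp: val_BNode_eq_0 simp del: val.simps)
      then show ?thesis by (intro exI[of _ 0] exI[of _ "gen_form 0"]) auto
    next
      case True
      then obtain x y z where bs: "bs = [x, y, z]" by (auto simp: length_3_iff)
      consider "p = []" | p' where "p = 0 # p'" "sub_at p' x = BNode t0 cs"
        | p' where "p = 1 # p'" "sub_at p' y = BNode t0 cs"
        | p' where "p = 2 # p'" "sub_at p' z = BNode t0 cs"
        using W.prems unfolding BNode bs
        by (cases p) (auto simp: less_Suc_eq nth_Cons' numeral_2_eq_2 split: if_splits)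
      then show ?thesis
      proof cases
        case 1
        then show ?thesis
          unfolding BNode bs using W.prems
          by (intro exI[of _ "val a x * val b y * val c z"] exI[of _ "prod_form i"]) auto
      next
        case (2 p')
        then obtain K F where "F \<in> range gen_form \<or> F \<in> prod_form ` {1, 2}"
          "\<And>u. val a (relabel p' u x) = (K * F u :: 'k)"
          using W.IH(1) W.prems by (meson wfc.simps)
        then show ?thesis
          unfolding BNode bs 2
          by (intro exI[of _ "prod_form i t * K * val b y * val c z"] exI[of _ F]) auto
      next
        case (3 p')
        then obtain K F where "F \<in> range gen_form \<or> F \<in> prod_form ` {1, 2}"
          "\<And>u. val b (relabel p' u y) = (K * F u :: 'k)"
          using W.IH(2) W.prems by (meson wfc.simps)
        then show ?thesis
          unfolding BNode bs 3
          by (intro exI[of _ "prod_form i t * val a x * K * val c z"] exI[of _ F]) auto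
      next
        case (4 p')
        then obtain K F where "F \<in> range gen_form \<or> F \<in> prod_form ` {1, 2}"
          "\<And>u. val c (relabel p' u z) = (K * F u :: 'k)"
          using W.IH(3) W.prems by (meson wfc.simps)
        then show ?thesis
          unfolding BNode bs 4
          by (intro exI[of _ "prod_form i t * val a x * val b y * K"] exI[of _ F]) auto
      qed
    qed
  qed
qed

text \<open>By \<open>val_relabel\<close> only one form sees the varying decoration, and it kills
  the ideal: \<open>gen_form\<close> for reasons of weight, \<open>prod_form\<close> by
  \<open>ideal_props\<close>. Hence \<open>val c\<close> descends to the bar construction of the
  quotient.\<close>

lemma bar_rel_val:
  assumes "x \<in> bar_rel gens two (rels :: (tree \<Rightarrow> 'k::field) set)" "wfc c"
  shows "fvec x \<and> pair x (val c) = 0"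
  using assms(1)
proof induction
  case (add x y)
  then show ?case
    using fvec_add[of x y] pair_add[of x y "val c"] unfolding plus_fun_def by auto
next
  case (smult x a)
  then show ?case by (simp add: fvec_scale pair_scale)
next
  case (gen B p t0 cs f)
  obtain K F where F: "F \<in> range gen_form \<or> F \<in> prod_form ` {1, 2}"
      "\<And>u. val c (relabel p u B) = (K * F u :: 'k)"
    using val_relabel[OF assms(2) gen(2)] by metis
  have f: "fvec f" "\<forall>t\<in>supp f. 2 \<le> weight t \<and> wft gens two t" "\<forall>i\<in>{1, 2}. pair f (prod_form i) = 0"
    using ideal_props[OF gen(3)] by auto
  have "pair f (gen_form l) = 0" for l
    using f(2) by (intro pair_eq_0 gen_form_eq_0) (auto simp: supp_def)
  then have "pair f F = 0"
    using F(1) f(3) by auto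
  then show ?case
    using f(1) F(2) by (simp add: fvec_lmap pair_lmap pair_scale_right)
qed auto

section \<open>The bar differential in terms of cells\<close>

lemma wfbs_eq: "wfbs Gs ar bs \<longleftrightarrow> (\<forall>b\<in>set bs. wfb Gs ar b)"
  by (induction bs) auto

lemma root_contr_elem:
  assumes "(s, X) \<in> set (root_contr t bs)"
  obtains j u cs where "j < length bs" "bs ! j = BNode u cs"
    "X = BNode (comp t j u) (take j bs @ cs @ drop (Suc j) bs)"
proof -
  define f where "f = (\<lambda>j. case bs ! j of BLeaf \<Rightarrow> []
      | BNode u cs \<Rightarrow> [((-1) ^ (Suc (nodess (take j bs))) :: int,
          BNode (comp t j u) (take j bs @ cs @ drop (Suc j) bs))])"
  have "(s, X) \<in> set (concat (map f [0..<length bs]))"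
    using assms unfolding root_contr_def f_def .
  then obtain j where "j < length bs" "(s, X) \<in> set (f j)"
    by auto
  then show ?thesis using that by (cases "bs ! j") (auto simp: f_def)
qed

lemma root_contr_eq_0:
  assumes "\<And>j u cs. j < length bs \<Longrightarrow> bs ! j = BNode u cs \<Longrightarrow>
    F (BNode (comp t j u) (take j bs @ cs @ drop (Suc j) bs)) = 0"
  shows "lev F (root_contr t bs) = 0"
  using assms by (intro lev_eq_0) (auto elim!: root_contr_elem)

lemma wfb_weight_pos: "wfb Gs ar (BNode u cs) \<Longrightarrow> 0 < weight u"
  by (cases u) auto

lemma weight_comp_ge:
  assumes "wfb2 (BNode t bs)" "j < length bs" "bs ! j = BNode u cs"
  shows "weight (comp t j u) = weight t + weight u" "0 < weight t" "0 < weight u"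
proof -
  have "bs ! j \<in> set bs" using nth_mem[OF assms(2)] .
  then have "wfb2 (bs ! j)" using assms(1) unfolding wfb.simps wfbs_eq by blast
  then show "0 < weight u" using assms(3) by (simp only: wfb_weight_pos)
qed (use assms in \<open>auto simp: weight_comp wfb_weight_pos\<close>)

lemma length_dls: "(s, ys) \<in> set (dls bs) \<Longrightarrow> length ys = length bs"
  by (induction bs arbitrary: s ys) auto

lemma lev_dls:
  "lev F (dls (b # bs)) = lev (\<lambda>x. F (x # bs)) (dl b) + (-1) ^ nodes b * lev (\<lambda>ys. F (b # ys)) (dls bs)"
  by simp

text \<open>Contraction at the root creates a decoration of weight at least 2, which
  \<open>gen_form\<close> does not see.\<close>

lemma lev_root_contr_V:
  assumes "wfb2 (BNode t bs)"
  shows "lev (val (V l a b)) (root_contr t bs) = 0"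
proof (rule root_contr_eq_0)
  fix j u cs assume "j < length bs" "bs ! j = BNode u cs"
  from weight_comp_ge[OF assms this] have "weight (comp t j u) \<noteq> 1" by linarith
  then show "val (V l a b) (BNode (comp t j u) (take j bs @ cs @ drop (Suc j) bs)) = 0"
    by (auto simp: gen_form_eq_0 split: list.splits)
qed

text \<open>Weight 2 arises only by merging two generators. At the second input their product is
  zero; at the first one the form \<open>prod_form i\<close> splits as \<open>gen_form 0\<close> of
  the parent times \<open>gen_form i\<close> of the child.\<close>

lemma lev_root_contr_W:
  assumes B: "wfb2 (BNode t bs)"
  shows "lev (val (W i a b c)) (root_contr t bs) = (- val (V 0 (V i a b) c) (BNode t bs) :: 'k::field)"
proof (cases "weight t = 1")
  case False
  have "lev (val (W i a b c)) (root_contr t bs) = (0 :: 'k)"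
  proof (rule root_contr_eq_0)
    fix j u cs assume "j < length bs" "bs ! j = BNode u cs"
    from weight_comp_ge[OF B this] False have "weight (comp t j u) \<noteq> 2" by linarith
    then show "val (W i a b c) (BNode (comp t j u) (take j bs @ cs @ drop (Suc j) bs)) = (0 :: 'k)"
      by (auto simp: prod_form_eq_0 split: list.splits)
  qed
  with False show ?thesis
    by (auto simp: gen_form_eq_0 split: list.splits)
next
  case True
  then obtain g where t: "t = corolla g" using B weight_1_cases by auto
  obtain x y where bs: "bs = [x, y]" using B t by (auto simp: length_Suc_conv)
  have y: "lev (val (W i a b c)) (case y of BLeaf \<Rightarrow> [] | BNode u cs \<Rightarrow>
      [(s, BNode (comp t 1 u) (x # cs))]) = (0 :: 'k)" for s
  proof (cases y)
    case (BNode u cs)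
    then obtain h us where u: "u = Node h us" using B bs by (cases u) auto
    have "comp t 1 u = Node g [Leaf, u]" by (simp add: comp_def t)
    then show ?thesis using BNode u by (auto split: list.splits)
  qed auto
  have x: "lev (val (W i a b c)) (case x of BLeaf \<Rightarrow> [] | BNode u cs \<Rightarrow>
      [(-1, BNode (comp t 0 u) (cs @ [y]))]) = (- val (V 0 (V i a b) c) (BNode t bs) :: 'k)"
  proof (cases x)
    case (BNode u cs)
    have comp: "comp (corolla g) 0 u = Node g [u, Leaf]" for u by (simp add: comp_def)
    show ?thesis
    proof (cases "weight u = 1")
      case True
      then obtain h where u: "u = corolla h" using B bs BNode weight_1_cases by auto
      then obtain x1 x2 where "cs = [x1, x2]" using B bs BNode by (auto simp: length_Suc_conv)
      \<comment> \<open>The factor of the parent is \<open>coord 0 g\<close>, which is 1 for every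
        generator.\<close>
      then show ?thesis using BNode by (simp add: comp u bs t coord_def)
    next
      case False
      then show ?thesis
        using BNode by (auto simp: comp bs t prod_form_eq_0 gen_form_eq_0 split: list.splits)
    qed
  qed (auto simp: bs)
  have "root_contr t bs = (case x of BLeaf \<Rightarrow> [] | BNode u cs \<Rightarrow> [(-1, BNode (comp t 0 u) (cs @ [y]))]) @
     (case y of BLeaf \<Rightarrow> [] | BNode u cs \<Rightarrow> [((-1) ^ Suc (nodes x), BNode (comp t 1 u) (x # cs))])"
    by (cases x; cases y) (simp_all add: root_contr_def bs upt_rec numeral_2_eq_2)
  then show ?thesis using x y by simp
qed

text \<open>\<open>expand\<close> transposes the differential: contraction at the root is seen by
  \<open>W\<close> alone and matches its cut term, and contractions inside the subtrees match by
  induction.\<close>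

lemma val_dl:
  "wfb2 B \<Longrightarrow> lev (val c) (dl B) = (lev (\<lambda>e. val e B) (expand c) :: 'k::field)"
proof (induction c arbitrary: B)
  case L
  have "lev (val L) (dl B) = (0::'k)"
  proof (rule lev_eq_0)
    fix s X assume "(s, X) \<in> set (dl B)"
    then show "val L X = (0::'k)"
      by (cases B) (auto elim!: root_contr_elem)
  qed
  then show ?case by (simp only: expand.simps lev_simps)
next
  case (V l a b)
  show ?case
  proof (cases B)
    case BLeaf
    have "lev (\<lambda>e. val e B) (expand (V l a b)) = (0::'k)"
      unfolding BLeaf by (intro lev_eq_0) (auto simp: val_BLeaf)
    then show ?thesis using BLeaf by simp
  next
    case (BNode t bs)
    have root: "lev (val (V l a b)) (dl B) = (- lev (\<lambda>ys. val (V l a b) (BNode t ys)) (dls bs) :: 'k)"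
      using V.prems unfolding BNode dl.simps lev_simps lev_map by (subst lev_root_contr_V) auto
    show ?thesis
    proof (cases "length bs = 2")
      case False
      have "lev (\<lambda>ys. val (V l a b) (BNode t ys)) (dls bs) = (0::'k)"
        using False length_dls by (intro lev_eq_0 val_BNode_eq_0) metis
      moreover have "lev (\<lambda>e. val e B) (expand (V l a b)) = (0::'k)"
        using False by (intro lev_eq_0) (auto simp: BNode split: list.splits)
      ultimately show ?thesis using root by (simp only: minus_zero)
    next
      case True
      then obtain x y where bs: "bs = [x, y]" by (auto simp: length_2_iff)
      have IH: "lev (val a) (dl x) = (lev (\<lambda>e. val e x) (expand a) :: 'k)"
        "lev (val b) (dl y) = (lev (\<lambda>e. val e y) (expand b) :: 'k)"
        using V BNode bs by auto
      \<comment> \<open>Either \<open>val a x\<close> is zero, or \<open>x\<close> has exactly as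
        many nodes as \<open>a\<close>.\<close>
      have sign: "(-1) ^ nodes x * (val a x :: 'k) = (-1) ^ cnodes a * val a x"
        using val_degrees[where ?'a = 'k, of a x] by (cases "val a x = (0::'k)") auto
      let ?p = "gen_form l t :: 'k"
      have scale: "lev (\<lambda>e. ?p * f e * v) xs = ?p * lev f xs * v"
        "lev (\<lambda>e. ?p * v * f e) xs = ?p * v * lev f xs"
        for f :: "'z \<Rightarrow> 'k" and v xs
        using lev_scale[of "?p * v" f xs] by (simp_all add: mult_ac)
      have "lev (\<lambda>ys. val (V l a b) (BNode t ys)) (dls bs) =
          ?p * lev (val a) (dl x) * val b y + ?p * ((-1) ^ nodes x * val a x) * lev (val b) (dl y)"
        by (simp add: bs lev_dls scale del: dls.simps(2); simp add: algebra_simps)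
      also have "\<dots> = - lev (\<lambda>e. val e B) (expand (V l a b))"
        unfolding lev_expand_V sign IH
        by (simp add: BNode bs scale; simp add: algebra_simps)
      finally show ?thesis unfolding root by simp
    qed
  qed
next
  case (W i a b c)
  show ?case
  proof (cases B)
    case BLeaf
    have "lev (\<lambda>e. val e B) (expand (W i a b c)) = (0::'k)"
      unfolding BLeaf by (intro lev_eq_0) (auto simp: val_BLeaf)
    then show ?thesis using BLeaf by simp
  next
    case (BNode t bs)
    let ?r = "- val (V 0 (V i a b) c) B :: 'k"
    have root: "lev (val (W i a b c)) (dl B) = ?r - lev (\<lambda>ys. val (W i a b c) (BNode t ys)) (dls bs)"
      using W.prems unfolding BNode dl.simps lev_simps lev_map by (subst lev_root_contr_W) auto
    show ?thesis
    proof (cases "length bs = 3")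
      case False
      have "lev (\<lambda>ys. val (W i a b c) (BNode t ys)) (dls bs) = (0::'k)"
        using False length_dls by (intro lev_eq_0 val_BNode_eq_0) metis
      moreover have "val (W i a' b' c') B = (0::'k)" for a' b' c'
        using False val_BNode_eq_0 BNode by blast
      then have "lev (\<lambda>e. val e B) (expand (W i a b c)) = ?r"
        unfolding lev_expand_W by (simp only: lev_eq_0) simp
      ultimately show ?thesis using root by (simp only: diff_0_right)
    next
      case True
      then obtain x y z where bs: "bs = [x, y, z]" by (auto simp: length_3_iff)
      have IH: "lev (val a) (dl x) = (lev (\<lambda>e. val e x) (expand a) :: 'k)"
        "lev (val b) (dl y) = (lev (\<lambda>e. val e y) (expand b) :: 'k)"
        "lev (val c) (dl z) = (lev (\<lambda>e. val e z) (expand c) :: 'k)"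
        using W BNode bs by auto
      have sign: "(-1) ^ nodes x * (val a x :: 'k) = (-1) ^ cnodes a * val a x"
        "(-1) ^ nodes y * (val b y :: 'k) = (-1) ^ cnodes b * val b y"
        using val_degrees[where ?'a = 'k, of a x] val_degrees[where ?'a = 'k, of b y]
        by (cases "val a x = (0::'k)"; cases "val b y = (0::'k)"; auto)+
      let ?p = "prod_form i t :: 'k"
      have scale: "lev (\<lambda>e. ?p * f e * v * w) xs = ?p * lev f xs * v * w"
        "lev (\<lambda>e. ?p * v * f e * w) xs = ?p * v * lev f xs * w"
        "lev (\<lambda>e. ?p * v * w * f e) xs = ?p * v * w * lev f xs"
        for f :: "'z \<Rightarrow> 'k" and v w xs
        using lev_scale[of "?p * v * w" f xs] by (simp_all add: mult_ac)
      have "lev (\<lambda>ys. val (W i a b c) (BNode t ys)) (dls bs) =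
          ?p * lev (val a) (dl x) * val b y * val c z +
          ?p * ((-1) ^ nodes x * val a x) * lev (val b) (dl y) * val c z +
          ?p * ((-1) ^ nodes x * val a x) * ((-1) ^ nodes y * val b y) * lev (val c) (dl z)"
        by (simp add: bs lev_dls scale del: dls.simps(2); simp add: algebra_simps)
      also have "\<dots> = ?r - lev (\<lambda>e. val e B) (expand (W i a b c))"
        unfolding lev_expand_W sign IH
        by (simp add: BNode bs scale; simp add: power_add algebra_simps)
      finally show ?thesis unfolding root by simp
    qed
  qed
qed

lemma btree_list_induct [case_names BLeaf BNode Nil Cons]:
  assumes "P BLeaf" "\<And>t bs. Q bs \<Longrightarrow> P (BNode t bs)" "Q []"
    "\<And>b bs. P b \<Longrightarrow> Q bs \<Longrightarrow> Q (b # bs)"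
  shows "P b" "Q bs"
  using nodes_nodess.induct[of P Q b bs] assms by blast+

lemma wfb_root_contr:
  assumes "(s, X) \<in> set (root_contr t bs)" "wfb Gs ar (BNode t bs)"
  shows "wfb Gs ar X"
proof -
  obtain j u cs where j: "j < length bs" "bs ! j = BNode u cs"
    and X: "X = BNode (comp t j u) (take j bs @ cs @ drop (Suc j) bs)"
    using assms(1) by (rule root_contr_elem)
  have "wfb Gs ar (bs ! j)"
    using nth_mem[OF j(1)] assms(2) unfolding wfb.simps wfbs_eq by blast
  then have u: "wft Gs ar u" "u \<noteq> Leaf" "length cs = leaves u" "\<forall>b\<in>set cs. wfb Gs ar b"
    by (auto simp: j wfbs_eq)
  have t: "wft Gs ar t" "t \<noteq> Leaf" "length bs = leaves t" "\<forall>b\<in>set bs. wfb Gs ar b"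
    using assms(2) by (auto simp: wfbs_eq)
  have "0 < weight t" using t(2) by (cases t) auto
  then have "comp t j u \<noteq> Leaf"
    using weight_comp[of j t u] j(1) t(3) by auto
  then show ?thesis
    using j(1) u t by (auto simp: X wft_comp leaves_comp wfbs_eq dest: in_set_takeD in_set_dropD)
qed

lemma wfb_dl:
  "(s, X) \<in> set (dl B) \<Longrightarrow> wfb Gs ar B \<Longrightarrow> wfb Gs ar X"
  "(s, Y) \<in> set (dls bs) \<Longrightarrow> wfbs Gs ar bs \<Longrightarrow> wfbs Gs ar Y"
proof (induction B and bs arbitrary: s X and s Y rule: btree_list_induct)
  case (BNode t bs)
  then show ?case using length_dls by (fastforce dest: wfb_root_contr)
qed auto

section \<open>Chains dual to the cells\<close>

text \<open>The bilinear extension of \<open>h\<close> to formal combinations; nesting with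
  \<open>Pair\<close> covers vertices with two or three subtrees.\<close>

definition combine :: "('a \<Rightarrow> 'b \<Rightarrow> 'c) \<Rightarrow> (int \<times> 'a) list \<Rightarrow> (int \<times> 'b) list \<Rightarrow> (int \<times> 'c) list" where
  "combine h us xs = concat (map (\<lambda>(s, u). map (\<lambda>(a, x). (s * a, h u x)) xs) us)"

lemma lev_combine: "lev F (combine h us xs) = lev (\<lambda>u. lev (\<lambda>x. F (h u x)) xs) us"
proof -
  have "lev F (map (\<lambda>(a, x). (s * a, h u x)) xs) = of_int s * lev (\<lambda>x. F (h u x)) xs" for s u
    by (induction xs) (auto simp: algebra_simps)
  then show ?thesis
    by (induction us) (auto simp: combine_def)
qed

lemma set_combine: "snd ` set (combine h us xs) = (\<lambda>(u, x). h u x) ` (snd ` set us \<times> snd ` set xs)"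
  by (force simp: combine_def image_iff)

lemma lev_scale_right: "lev (\<lambda>e. F e * K) xs = lev F xs * K"
  using lev_scale[of K F xs] by (simp add: mult.commute)

fun dual_gen :: "nat \<Rightarrow> (int \<times> tree) list" where
  "dual_gen l = (if l = 0 then [(1, corolla 0), (1, corolla 1), (-1, corolla 2)]
     else if l = 1 then [(1, corolla 2), (-1, corolla 1)]
     else [(1, corolla 2), (-1, corolla 0)])"

text \<open>Each basis element is replaced by a representative over the given generators. For i = 1,
  2 the generator i - 1 is w + k_i, so \<open>comb 0 (i - 1)\<close> represents w k_i.\<close>

primrec dual :: "cell \<Rightarrow> (int \<times> btree) list" where
  "dual L = [(1, BLeaf)]"
| "dual (V l a b) = combine (\<lambda>t (x, y). BNode t [x, y]) (dual_gen l) (combine Pair (dual a) (dual b))"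
| "dual (W i a b c) = combine (\<lambda>t (x, y, z). BNode t [x, y, z]) [(1, comb 0 (i - 1))]
     (combine Pair (dual a) (combine Pair (dual b) (dual c)))"

lemma lev_dual_gen: "l \<le> 2 \<Longrightarrow> l' \<le> 2 \<Longrightarrow> lev (gen_form l') (dual_gen l) = (if l = l' then 1 else 0)"
  by (auto simp: coord_def le_Suc_eq numeral_2_eq_2)

lemma dual_support:
  assumes "wfc c" "B \<in> snd ` set (dual c)"
  shows "wfb2 B \<and> nodes B = cnodes c \<and> bweight B = cweight c"
  using assms
proof (induction c arbitrary: B)
  case (V l a b)
  then obtain t x y where "B = BNode t [x, y]" "t \<in> snd ` set (dual_gen l)"
    "x \<in> snd ` set (dual a)" "y \<in> snd ` set (dual b)"
    by (auto simp: set_combine simp del: dual_gen.simps)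
  with V show ?case by (auto split: if_splits)
next
  case (W i a b c)
  then obtain x y z where "B = BNode (comb 0 (i - 1)) [x, y, z]"
    "x \<in> snd ` set (dual a)" "y \<in> snd ` set (dual b)" "z \<in> snd ` set (dual c)"
    by (auto simp: set_combine)
  with W show ?case by auto
qed auto

text \<open>The pairing is a product over the vertices, and at one vertex it is the duality of the
  two bases. This biorthogonality permits chains with prescribed values on finitely many
  cells.\<close>

lemma lev_dual: "wfc c \<Longrightarrow> wfc c' \<Longrightarrow> lev (val c') (dual c) = (if c' = c then 1 else 0 :: 'k::field)"
proof (induction c arbitrary: c')
  case L
  then show ?case by (cases c') auto
next
  case (V l a b)
  have K: "lev (val c') (dual (V l a b)) = lev (\<lambda>t. lev (\<lambda>x. lev (\<lambda>y.
      val c' (BNode t [x, y]) :: 'k) (dual b)) (dual a)) (dual_gen l)"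
    by (simp add: lev_combine del: dual_gen.simps)
  show ?case
  proof (cases c')
    case (V l' a' b')
    have "lev (val c') (dual (V l a b)) =
        (lev (gen_form l') (dual_gen l) * lev (val a') (dual a) * lev (val b') (dual b) :: 'k)"
      unfolding K unfolding V by (simp add: lev_scale lev_scale_right mult.assoc del: dual_gen.simps)
    then show ?thesis
      using V.IH V.prems \<open>c' = V l' a' b'\<close> lev_dual_gen[where ?'a = 'k, of l l'] by (simp del: dual_gen.simps dual.simps val.simps)
  qed (unfold K, simp_all add: lev_eq_0 del: dual_gen.simps)
next
  case (W i a b c)
  have K: "lev (val c') (dual (W i a b c)) = lev (\<lambda>x. lev (\<lambda>y. lev (\<lambda>z.
      val c' (BNode (comb 0 (i - 1)) [x, y, z]) :: 'k) (dual c)) (dual b)) (dual a)"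
    by (simp add: lev_combine)
  show ?case
  proof (cases c')
    case (W i' a1 b1 c1)
    have "lev (val c') (dual (W i a b c)) = (prod_form i' (comb 0 (i - 1)) *
        (lev (val a1) (dual a) * (lev (val b1) (dual b) * lev (val c1) (dual c))) :: 'k)"
      unfolding K unfolding W by (simp add: lev_scale lev_scale_right mult.assoc del: form_simps)
    moreover have "prod_form i' (comb 0 (i - 1)) = (if i' = i then 1 else 0 :: 'k)"
      using W.prems \<open>c' = W i' a1 b1 c1\<close> by (auto simp: coord_def)
    ultimately show ?thesis
      using W.IH W.prems \<open>c' = W i' a1 b1 c1\<close> by (simp del: form_simps dual.simps val.simps)
  qed (unfold K, simp_all add: lev_eq_0)
qed

section \<open>Normal forms modulo the bar relations\<close>

abbreviation brel :: "(btree \<Rightarrow> 'k::field) set" where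
  "brel \<equiv> bar_rel gens two rels"

lemma fvec_pair_sum:
  assumes "finite S" "\<And>a. a \<in> S \<Longrightarrow> fvec (v a)"
  shows "fvec (\<lambda>b. \<Sum>a\<in>S. g a * v a b :: 'k::field) \<and>
    pair (\<lambda>b. \<Sum>a\<in>S. g a * v a b) F = (\<Sum>a\<in>S. g a * pair (v a) F)"
  using assms
proof (induction S)
  case (insert a S)
  have eq: "(\<lambda>b. \<Sum>a\<in>insert a S. g a * v a b) = (\<lambda>b. g a * v a b) + (\<lambda>b. \<Sum>a\<in>S. g a * v a b)"
    using insert.hyps by (simp add: fun_eq_iff)
  let ?r = "\<lambda>b. \<Sum>a\<in>S. g a * v a b"
  have r: "fvec ?r" "pair ?r F = (\<Sum>a\<in>S. g a * pair (v a) F)"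
    using insert by auto
  have a: "fvec (v a)" using insert.prems by simp
  show ?case
    unfolding eq using insert.hyps fvec_add[OF fvec_scale[OF a] r(1)]
    by (simp only: pair_add[OF fvec_scale[OF a] r(1)] pair_scale[OF a] r(2) sum.insert simp_thms)
qed simp

lemma bar_rel_sum:
  assumes "finite S" "\<And>a. a \<in> S \<Longrightarrow> v a \<in> bar_rel Gs ar R"
  shows "(\<lambda>b. \<Sum>a\<in>S. g a * v a b :: 'k::field) \<in> bar_rel Gs ar R"
  using assms
proof (induction S)
  case empty
  then show ?case using bar_rel.zero by (simp add: zero_fun_def)
next
  case (insert a S)
  have eq: "(\<lambda>b. \<Sum>a\<in>insert a S. g a * v a b) = (\<lambda>b. g a * v a b) + (\<lambda>b. \<Sum>a\<in>S. g a * v a b)"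
    using insert.hyps by (simp add: fun_eq_iff)
  show ?case
    unfolding eq using insert by (intro bar_rel.add bar_rel.smult) auto
qed

text \<open>Counts the vertices not decorated by a basis monomial; it is the measure for rewriting
  one vertex at a time.\<close>

primrec defect :: "btree \<Rightarrow> nat" and defects :: "btree list \<Rightarrow> nat" where
  "defect BLeaf = 0"
| "defect (BNode t bs) = (if normal_tree t then 0 else 1) + defects bs"
| "defects [] = 0"
| "defects (b # bs) = defect b + defects bs"

lemma defects_update: "j < length bs \<Longrightarrow> defects (bs[j := b]) + defect (bs ! j) = defects bs + defect b"
  by (induction bs arbitrary: j) (auto simp: less_Suc_eq_0_disj)

lemma defects_pos: "defects bs \<noteq> 0 \<Longrightarrow> \<exists>b\<in>set bs. defect b \<noteq> 0"
  by (induction bs) auto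

text \<open>The equation \<open>relabel p t B = B\<close> exhibits \<open>bvec B\<close> as the
  image of \<open>bvec t\<close> under relabelling, which is the form that the generators of
  \<open>bar_rel\<close> require.\<close>

lemma defective_vertex:
  assumes "wfb2 B" "defect B \<noteq> 0"
  shows "\<exists>p t cs. sub_at p B = BNode t cs \<and> wft gens two t \<and> t \<noteq> Leaf \<and> relabel p t B = B \<and>
    (\<forall>u. normal_tree u \<longrightarrow> leaves u = leaves t \<longrightarrow> wfb2 (relabel p u B) \<and> defect (relabel p u B) < defect B)"
  using assms
proof (induction B)
  case (BNode t bs)
  have normal: "wft gens two u \<and> u \<noteq> Leaf" if "normal_tree u" for u
    using that by (auto simp: normal_tree_def)
  show ?case
  proof (cases "normal_tree t")
    case False
    then show ?thesis
      using BNode.prems normal by (intro exI[of _ "[]"] exI[of _ t] exI[of _ bs]) auto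
  next
    case True
    then have "defects bs \<noteq> 0" using BNode.prems by simp
    then obtain j where j: "j < length bs" "defect (bs ! j) \<noteq> 0"
      using defects_pos by (metis in_set_conv_nth)
    have mem: "bs ! j \<in> set bs" using j(1) by simp
    have "wfb2 (bs ! j)"
      using mem BNode.prems(1) unfolding wfb.simps wfbs_eq by blast
    from BNode.IH[OF mem this j(2)] obtain p t0 cs where p:
      "sub_at p (bs ! j) = BNode t0 cs" "wft gens two t0" "t0 \<noteq> Leaf" "relabel p t0 (bs ! j) = bs ! j"
      "\<And>u. normal_tree u \<Longrightarrow> leaves u = leaves t0 \<Longrightarrow>
        wfb2 (relabel p u (bs ! j)) \<and> defect (relabel p u (bs ! j)) < defect (bs ! j)"
      by blast
    have "wfb2 (relabel (j # p) u (BNode t bs)) \<and> defect (relabel (j # p) u (BNode t bs)) < defect (BNode t bs)"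
      if u: "normal_tree u" "leaves u = leaves t0" for u
    proof
      show "wfb2 (relabel (j # p) u (BNode t bs))"
        using j(1) BNode.prems(1) p(5)[OF u] by (auto simp: wfbs_eq dest!: set_update_subset_insert[THEN subsetD])
      show "defect (relabel (j # p) u (BNode t bs)) < defect (BNode t bs)"
        using j(1) p(5)[OF u] defects_update[OF j(1), of "relabel p u (bs ! j)"] by simp
    qed
    moreover have "sub_at (j # p) (BNode t bs) = BNode t0 cs" "relabel (j # p) t0 (BNode t bs) = BNode t bs"
      using j(1) p by simp_all
    ultimately show ?thesis
      using p(2,3) by blast
  qed
qed auto

definition normal :: "btree \<Rightarrow> bool" where
  "normal B \<longleftrightarrow> wfb2 B \<and> defect B = 0"

lemma vec_append: "vec (xs @ ys) = (vec xs + vec ys :: 'a \<Rightarrow> 'k::field)"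
  by (simp add: vec_def fun_eq_iff)

lemma vec_scale: "vec (map (\<lambda>(a, y). (s * a, y)) ys) = (\<lambda>b. of_int s * vec ys b :: 'k::field)"
proof
  fix b
  show "vec (map (\<lambda>(a, y). (s * a, y)) ys) b = (of_int s * vec ys b :: 'k)"
    unfolding vec_def by (induction ys) (auto simp: algebra_simps)
qed

lemma lmap_vec: "lmap \<phi> (vec xs) = (vec (map (apsnd \<phi>) xs) :: 'b \<Rightarrow> 'k::field)"
proof -
  have "lev F (map (apsnd \<phi>) xs) = lev (\<lambda>x. F (\<phi> x)) xs" for F :: "'b \<Rightarrow> 'k"
    by (induction xs) auto
  then show ?thesis by (simp add: lmap_eq pair_vec) (simp add: vec_def)
qed

lemma normalise_vec:
  assumes "\<And>s B. (s, B) \<in> set xs \<Longrightarrow> \<exists>ys. (\<forall>Y\<in>snd ` set ys. normal Y) \<and> bvec B - vec ys \<in> (brel :: (btree \<Rightarrow> 'k::field) set)"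
  shows "\<exists>ys. (\<forall>Y\<in>snd ` set ys. normal Y) \<and> vec xs - vec ys \<in> (brel :: (btree \<Rightarrow> 'k::field) set)"
  using assms
proof (induction xs)
  case Nil
  then show ?case
    using bar_rel.zero[of gens two rels] by (intro exI[of _ "[]"]) (simp add: zero_fun_def)
next
  case (Cons sB xs)
  obtain s B where sB: "sB = (s, B)" by (cases sB)
  obtain ys where ys: "\<forall>Y\<in>snd ` set ys. normal Y" "bvec B - vec ys \<in> (brel :: (btree \<Rightarrow> 'k) set)"
    using Cons.prems[of s B] unfolding sB by (meson list.set_intros(1))
  have "\<exists>zs. (\<forall>Y\<in>snd ` set zs. normal Y) \<and> vec xs - vec zs \<in> (brel :: (btree \<Rightarrow> 'k) set)"
    using Cons.prems by (intro Cons.IH) auto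
  then obtain zs where zs: "\<forall>Y\<in>snd ` set zs. normal Y" "vec xs - vec zs \<in> (brel :: (btree \<Rightarrow> 'k) set)"
    by blast
  have "(\<lambda>b. of_int s * (bvec B - vec ys) b) + (vec xs - vec zs) \<in> (brel :: (btree \<Rightarrow> 'k) set)"
    using ys zs by (intro bar_rel.add bar_rel.smult)
  moreover have "(\<lambda>b. of_int s * (bvec B - vec ys) b) + (vec xs - vec zs) =
      (vec (sB # xs) - vec (map (\<lambda>(a, y). (s * a, y)) ys @ zs) :: btree \<Rightarrow> 'k)"
    unfolding vec_append vec_scale sB vec_simps by (simp add: fun_eq_iff algebra_simps)
  ultimately have "vec (sB # xs) - vec (map (\<lambda>(a, y). (s * a, y)) ys @ zs) \<in> (brel :: (btree \<Rightarrow> 'k) set)"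
    by (simp only:)
  moreover have "\<forall>Y\<in>snd ` set (map (\<lambda>(a, y). (s * a, y)) ys @ zs). normal Y"
    using ys(1) zs(1) by auto
  ultimately show ?case by blast
qed

text \<open>Rewriting one vertex by \<open>normalise_tree\<close> stays in the same class modulo
  \<open>bar_rel\<close>, and every tree produced has smaller defect.\<close>

lemma normalise_btree:
  "wfb2 B \<Longrightarrow> \<exists>ys. (\<forall>Y\<in>snd ` set ys. normal Y) \<and> bvec B - vec ys \<in> (brel :: (btree \<Rightarrow> 'k::field) set)"
proof (induction "defect B" arbitrary: B rule: less_induct)
  case less
  show ?case
  proof (cases "defect B = 0")
    case True
    then show ?thesis
      using less.prems bar_rel.zero by (intro exI[of _ "[(1, B)]"]) (auto simp: normal_def)
  next
    case False
    then obtain p t cs where p: "sub_at p B = BNode t cs" "wft gens two t" "t \<noteq> Leaf" "relabel p t B = B"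
      "\<And>u. normal_tree u \<Longrightarrow> leaves u = leaves t \<Longrightarrow> wfb2 (relabel p u B) \<and> defect (relabel p u B) < defect B"
      using defective_vertex[OF less.prems] by blast
    obtain xs where xs: "\<forall>(s, u)\<in>set xs. normal_tree u \<and> leaves u = leaves t"
      "bvec t - vec xs \<in> (ideal :: (tree \<Rightarrow> 'k) set)"
      using normalise_tree[OF p(2,3)] by blast
    have "\<forall>u\<in>supp (bvec t - vec xs :: tree \<Rightarrow> 'k). leaves u = leaves t"
      using supp_diff[of "bvec t :: tree \<Rightarrow> 'k" "vec xs"] supp_vec[of xs, where ?'b = 'k] xs(1) by fastforce
    from bar_rel.gen[OF less.prems p(1) xs(2) this]
    have "bvec B - vec (map (apsnd (\<lambda>u. relabel p u B)) xs) \<in> (brel :: (btree \<Rightarrow> 'k) set)"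
      by (simp add: lmap_diff lmap_vec p(4))
    moreover have "\<exists>ys. (\<forall>Y\<in>snd ` set ys. normal Y) \<and>
        vec (map (apsnd (\<lambda>u. relabel p u B)) xs) - vec ys \<in> (brel :: (btree \<Rightarrow> 'k) set)"
      using xs(1) p(5) by (intro normalise_vec less.hyps) auto
    then obtain ys where "\<forall>Y\<in>snd ` set ys. normal Y"
        "vec (map (apsnd (\<lambda>u. relabel p u B)) xs) - vec ys \<in> (brel :: (btree \<Rightarrow> 'k) set)"
      by blast
    ultimately show ?thesis
      using bar_rel.add[of "bvec B - vec (map (apsnd (\<lambda>u. relabel p u B)) xs)" gens two rels]
      by (intro exI[of _ ys]) fastforce
  qed
qed

text \<open>The change of basis on the dual side: the coefficient of the generator g, expressed by
  the coordinates along w, k_1, k_2.\<close>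

fun coords_gen :: "nat \<Rightarrow> (int \<times> nat) list" where
  "coords_gen g = (if g = 0 then [(1, 0), (-1, 2)]
     else if g = 1 then [(1, 0), (-1, 1)]
     else [(1, 1), (1, 2), (-1, 0)])"

lemma lev_coords_gen:
  assumes "g \<in> gens" "normal_tree t"
  shows "lev (\<lambda>l. gen_form l t) (coords_gen g) = (bvec (corolla g) t :: 'k::field)"
proof -
  consider h where "h \<in> gens" "t = corolla h" | "weight t \<noteq> 1" "t \<noteq> corolla g"
    using assms by (auto simp: normal_tree_def)
  then show ?thesis
  proof cases
    case 1
    then show ?thesis
      using assms(1) by (auto simp: gens_def coord_def bvec_def)
  next
    case 2
    then show ?thesis by (auto simp: gen_form_eq_0 bvec_def)
  qed
qed

lemma coords_gen_bound: "l \<in> snd ` set (coords_gen g) \<Longrightarrow> l \<le> 2"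
  by (auto split: if_splits)

text \<open>The index is shifted because for c = 0, 1 the generator c is w + k_(c+1).\<close>

lemma prod_form_normal:
  "c \<le> 1 \<Longrightarrow> normal_tree t \<Longrightarrow> prod_form (Suc c) t = (bvec (comb 0 c) t :: 'k::field)"
  by (auto simp: normal_tree_def prod_form_eq_0 bvec_def coord_def le_Suc_eq)

lemma normal_BNode: "normal (BNode t bs) \<longleftrightarrow>
    normal_tree t \<and> length bs = leaves t \<and> (\<forall>b\<in>set bs. normal b)"
proof -
  have "defects bs = 0 \<longleftrightarrow> (\<forall>b\<in>set bs. defect b = 0)" by (induction bs) auto
  moreover have "wft gens two t \<and> t \<noteq> Leaf" if "normal_tree t"
    using that by (auto simp: normal_tree_def)
  ultimately show ?thesis by (auto simp: normal_def wfbs_eq)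
qed

lemma bvec_BNode:
  "bvec (BNode t [x, y]) (BNode t' [x', y']) = (bvec t t' * bvec x x' * bvec y y' :: 'k::field)"
  "bvec (BNode t [x, y, z]) (BNode t' [x', y', z']) = (bvec t t' * bvec x x' * bvec y y' * bvec z z' :: 'k::field)"
  by (auto simp: bvec_def)

text \<open>The change of basis is inverted vertex by vertex, so the functionals separate
  combinations of normal trees. On other trees the identity may fail: \<open>prod_form\<close> does
  not tell apart different root labels.\<close>

lemma bvec_coordinates:
  "normal B \<Longrightarrow> \<exists>xs. (\<forall>c\<in>snd ` set xs. wfc c) \<and>
    (\<forall>B'. normal B' \<longrightarrow> lev (\<lambda>c. val c B') xs = (bvec B B' :: 'k::field))"
proof (induction B)
  case BLeaf
  then show ?case by (intro exI[of _ "[(1, L)]"]) (auto simp: bvec_def)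
next
  case (BNode t bs)
  define P where "P = (\<lambda>xs B. (\<forall>c\<in>snd ` set xs. wfc c) \<and>
    (\<forall>B'. normal B' \<longrightarrow> lev (\<lambda>c. val c B') xs = (bvec B B' :: 'k)))"
  have IH: "\<exists>xs. P xs b" if "b \<in> set bs" for b
    using BNode that unfolding P_def normal_BNode by blast
  consider g where "g \<in> gens" "t = corolla g" | c where "c \<le> 1" "t = comb 0 c"
    using BNode.prems by (auto simp: normal_BNode normal_tree_def)
  then have "\<exists>xs. P xs (BNode t bs)"
  proof cases
    case (1 g)
    then obtain x y where bs: "bs = [x, y]"
      using BNode.prems by (auto simp: normal_BNode length_Suc_conv)
    obtain xs ys where P: "P xs x" "P ys y" using IH bs by (meson list.set_intros)
    let ?zs = "combine (\<lambda>l (a, b). V l a b) (coords_gen g) (combine Pair xs ys)"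
    have "lev (\<lambda>c. val c B') ?zs = (bvec (BNode t bs) B' :: 'k)" if B': "normal B'" for B'
    proof -
      have lev: "lev (\<lambda>c. val c B') ?zs = (lev (\<lambda>l. lev (\<lambda>a. lev (\<lambda>b. val (V l a b) B') ys) xs) (coords_gen g) :: 'k)"
        by (simp add: lev_combine del: val.simps coords_gen.simps)
      show ?thesis
      proof (cases "\<exists>t' x' y'. B' = BNode t' [x', y']")
        case True
        then obtain t' x' y' where B'_eq: "B' = BNode t' [x', y']" by blast
        then have "normal_tree t'" "normal x'" "normal y'"
          using B' by (auto simp: normal_BNode)
        then show ?thesis
          unfolding lev using P lev_coords_gen[where ?'k = 'k, OF 1(1), of t']
          by (simp add: B'_eq bs 1(2) bvec_BNode P_def lev_scale lev_scale_right mult.assoc del: coords_gen.simps)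
      next
        case False
        then have "val (V l a b) B' = (0 :: 'k)" for l a b
          by (auto split: btree.splits list.splits)
        then have "lev (\<lambda>c. val c B') ?zs = (0 :: 'k)"
          unfolding lev by (simp add: lev_eq_0 del: val.simps coords_gen.simps)
        moreover have "bvec (BNode t bs) B' = (0 :: 'k)"
          using False by (auto simp: bvec_def bs)
        ultimately show ?thesis by simp
      qed
    qed
    moreover have "\<forall>c\<in>snd ` set ?zs. wfc c"
      using P coords_gen_bound[of _ g] unfolding set_combine P_def by (auto simp del: coords_gen.simps)
    ultimately show ?thesis unfolding P_def by blast
  next
    case (2 c)
    then obtain x y z where bs: "bs = [x, y, z]"
      using BNode.prems by (auto simp: normal_BNode length_Suc_conv)
    obtain xs ys zs where P: "P xs x" "P ys y" "P zs z" using IH bs by (meson list.set_intros)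
    let ?ws = "combine (\<lambda>i (a, b, d). W i a b d) [(1, Suc c)] (combine Pair xs (combine Pair ys zs))"
    have "lev (\<lambda>c. val c B') ?ws = (bvec (BNode t bs) B' :: 'k)" if B': "normal B'" for B'
    proof -
      have lev: "lev (\<lambda>c. val c B') ?ws = (lev (\<lambda>a. lev (\<lambda>b. lev (\<lambda>d. val (W (Suc c) a b d) B') zs) ys) xs :: 'k)"
        by (simp add: lev_combine del: val.simps)
      show ?thesis
      proof (cases "\<exists>t' x' y' z'. B' = BNode t' [x', y', z']")
        case True
        then obtain t' x' y' z' where B'_eq: "B' = BNode t' [x', y', z']" by blast
        then have "normal_tree t'" "normal x'" "normal y'" "normal z'"
          using B' by (auto simp: normal_BNode)
        then show ?thesis
          unfolding lev using P prod_form_normal[where ?'k = 'k, OF 2(1), of t']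
          by (simp add: B'_eq bs 2(2) bvec_BNode P_def lev_scale lev_scale_right mult.assoc)
      next
        case False
        then have "val (W i a b d) B' = (0 :: 'k)" for i a b d
          by (auto split: btree.splits list.splits)
        then have "lev (\<lambda>c. val c B') ?ws = (0 :: 'k)"
          unfolding lev by (simp add: lev_eq_0 del: val.simps)
        moreover have "bvec (BNode t bs) B' = (0 :: 'k)"
          using False by (auto simp: bvec_def bs)
        ultimately show ?thesis by simp
      qed
    qed
    moreover have "\<forall>c\<in>snd ` set ?ws. wfc c"
      using P 2(1) unfolding set_combine P_def by auto
    ultimately show ?thesis unfolding P_def by blast
  qed
  then show ?case unfolding P_def .
qed

text \<open>The converse of \<open>bar_rel_val\<close>. Modulo \<open>bar_rel\<close>,
  \<open>z\<close> equals a combination \<open>n\<close> of normal trees; its values are those of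
  \<open>z\<close>, hence zero, and every coefficient of \<open>n\<close> is a combination of such
  values.\<close>

lemma bar_rel_if_vals_0:
  fixes z :: "btree \<Rightarrow> 'k::field"
  assumes z: "fvec z" "\<And>B. B \<in> supp z \<Longrightarrow> wfb2 B" "\<And>c. wfc c \<Longrightarrow> pair z (val c) = 0"
  shows "z \<in> brel"
proof -
  have fin: "finite (supp z)" using z(1) by (simp add: fvec_def)
  have "\<forall>B\<in>supp z. \<exists>ys. (\<forall>Y\<in>snd ` set ys. normal Y) \<and> bvec B - vec ys \<in> (brel :: (btree \<Rightarrow> 'k) set)"
    using z(2) normalise_btree by blast
  then obtain N where N: "\<And>B Y. B \<in> supp z \<Longrightarrow> Y \<in> snd ` set (N B) \<Longrightarrow> normal Y"
      "\<And>B. B \<in> supp z \<Longrightarrow> bvec B - vec (N B) \<in> (brel :: (btree \<Rightarrow> 'k) set)"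
    by metis
  define n where "n = (\<lambda>X. \<Sum>B\<in>supp z. z B * vec (N B) X)"
  have z_eq: "z X = (\<Sum>B\<in>supp z. z B * bvec B X)" for X
    using pair_delta[OF z(1), of X] by (simp add: pair_def bvec_def eq_commute)
  have "z - n = (\<lambda>X. \<Sum>B\<in>supp z. z B * (bvec B - vec (N B)) X)"
    unfolding n_def fun_eq_iff by (simp add: z_eq[symmetric] right_diff_distrib sum_subtractf)
  then have rel: "z - n \<in> brel"
    using bar_rel_sum[OF fin N(2)] by simp
  have fn: "fvec n" unfolding n_def using fvec_pair_sum[OF fin, of "\<lambda>B. vec (N B) :: btree \<Rightarrow> 'k"] by simp
  have pn: "pair n (val c) = 0" if "wfc c" for c
    using bar_rel_val[OF rel that] z(3)[OF that] pair_diff[OF z(1) fn, of "val c"] by simp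
  have normal: "normal X" if "X \<in> supp n" for X
  proof (rule ccontr)
    assume "\<not> normal X"
    then have "X \<notin> supp (vec (N B) :: btree \<Rightarrow> 'k)" if "B \<in> supp z" for B
      using N(1)[OF that] supp_vec[of "N B", where ?'b = 'k] by blast
    then have "vec (N B) X = (0 :: 'k)" if "B \<in> supp z" for B
      using that by (simp add: supp_def)
    then have "n X = 0" unfolding n_def by (intro sum.neutral) auto
    with that show False by (simp add: supp_def)
  qed
  have "n X = 0" for X
  proof (cases "normal X")
    case True
    then obtain xs where xs: "\<forall>c\<in>snd ` set xs. wfc c"
      "\<And>B'. normal B' \<Longrightarrow> lev (\<lambda>c. val c B') xs = (bvec X B' :: 'k)"
      using bvec_coordinates by blast
    have "n X = pair n (bvec X)" using pair_delta[OF fn] by simp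
    also have "\<dots> = pair n (\<lambda>B'. lev (\<lambda>c. val c B') xs)"
      unfolding pair_def using xs(2) normal by (intro sum.cong) auto
    also have "\<dots> = lev (\<lambda>c. pair n (val c)) xs" by (rule pair_lev)
    also have "\<dots> = 0" using xs(1) pn by (intro lev_eq_0) force
    finally show ?thesis .
  next
    case False
    then show ?thesis using normal by (auto simp: supp_def)
  qed
  then have "z - n = z" by (simp add: fun_eq_iff)
  with rel show ?thesis by simp
qed

section \<open>Koszulness\<close>

text \<open>Guarantees that the sum defining the bounding chain is finite.\<close>

lemma finite_cells: "finite {c. wfc c \<and> cweight c \<le> n}"
proof (induction n)
  case 0
  have "c = L" if "cweight c \<le> 0" for c
    using that by (cases c) auto
  then have "{c. wfc c \<and> cweight c \<le> 0} \<subseteq> {L}" by blast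
  then show ?case by (rule finite_subset) simp
next
  case (Suc n)
  let ?C = "{c. wfc c \<and> cweight c \<le> n}"
  have "c \<in> insert L ((\<lambda>(l, a, b). V l a b) ` ({..2} \<times> ?C \<times> ?C) \<union>
      (\<lambda>(i, a, b, d). W i a b d) ` ({1, 2} \<times> ?C \<times> ?C \<times> ?C))" if "wfc c" "cweight c \<le> Suc n" for c
    using that by (cases c) (force simp: image_iff)+
  then have "{c. wfc c \<and> cweight c \<le> Suc n} \<subseteq> insert L ((\<lambda>(l, a, b). V l a b) ` ({..2} \<times> ?C \<times> ?C) \<union>
      (\<lambda>(i, a, b, d). W i a b d) ` ({1, 2} \<times> ?C \<times> ?C \<times> ?C))" by blast
  then show ?case by (rule finite_subset) (use Suc in auto)
qed

lemma koszul_rels: "koszul gens two (rels :: (tree \<Rightarrow> 'k::field) set)"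
  unfolding koszul_def
proof (intro allI impI)
  fix k w and x :: "btree \<Rightarrow> 'k"
  assume kw: "k < w" and x: "bar_chain gens two k w x" and cycle: "bar_d x \<in> brel"
  have fx: "fvec x" and wx: "\<And>B. B \<in> supp x \<Longrightarrow> wfb2 B \<and> nodes B = k \<and> bweight B = w"
    using x by (auto simp: bar_chain_def)
  have pair_d: "pair (bar_d u) (val c) = lev (\<lambda>e. pair u (val e)) (expand c)"
    if "fvec u" "\<And>B. B \<in> supp u \<Longrightarrow> wfb2 B" for u :: "btree \<Rightarrow> 'k" and c
  proof -
    have "pair (bar_d u) (val c) = pair u (\<lambda>B. lev (val c) (dl B))"
      by (rule pair_bar_d[OF that(1)])
    also have "\<dots> = pair u (\<lambda>B. lev (\<lambda>e. val e B) (expand c))"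
      unfolding pair_def using that(2) by (intro sum.cong) (auto simp: val_dl)
    finally show ?thesis by (simp only: pair_lev)
  qed
  \<comment> \<open>\<open>F\<close> records the values of \<open>x\<close> on cells, and
    \<open>G\<close> is the homotopy applied to \<open>F\<close>; a chain \<open>y\<close> with
    values \<open>G\<close> will bound \<open>x\<close>.\<close>
  define F where "F c = pair x (val c)" for c
  define G where "G c = lev F (contract c)" for c
  have F0: "F c = 0" if "cnodes c \<noteq> k \<or> cweight c \<noteq> w" for c
    unfolding F_def
  proof (rule pair_eq_0, rule ccontr)
    fix B assume "x B \<noteq> 0" "val c B \<noteq> (0 :: 'k)"
    then show False using wx[of B] val_degrees[of c B] that by (auto simp: supp_def)
  qed
  \<comment> \<open>The cycle condition modulo \<open>bar_rel\<close>, read on cells.\<close>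
  have dF: "lev F (expand c) = 0" if "wfc c" for c
    using bar_rel_val[OF cycle that] pair_d[OF fx, of c] wx by (simp add: F_def[abs_def])
  \<comment> \<open>\<open>contract\<close> removes one node and keeps the weight, so
    \<open>G\<close> is supported in bar degree k + 1.\<close>
  define S where "S = {c. wfc c \<and> cweight c = w \<and> cnodes c = Suc k}"
  have S: "finite S" by (rule finite_subset[OF _ finite_cells[of w]]) (auto simp: S_def)
  have G0: "G c = 0" if "wfc c" "c \<notin> S" for c
    unfolding G_def
  proof (intro lev_eq_0 F0)
    fix s e assume "(s, e) \<in> set (contract c)"
    from contract_invariants[OF this] that
    show "cnodes e \<noteq> k \<or> cweight e \<noteq> w" by (auto simp: S_def)
  qed
  define y where "y = (\<lambda>B. \<Sum>c\<in>S. G c * vec (dual c) B)"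
  have fy: "fvec y" and py: "pair y f = (\<Sum>c\<in>S. G c * lev f (dual c))" for f
    unfolding y_def using fvec_pair_sum[OF S, of "\<lambda>c. vec (dual c) :: btree \<Rightarrow> 'k" G f] by (simp_all add: pair_vec)
  have wy: "wfb2 B \<and> nodes B = Suc k \<and> bweight B = w" if "B \<in> supp y" for B
  proof (rule ccontr)
    assume B: "\<not> ?thesis"
    have "B \<notin> supp (vec (dual c) :: btree \<Rightarrow> 'k)" if "c \<in> S" for c
      using that B dual_support[of c B] supp_vec[of "dual c", where ?'b = 'k] unfolding S_def by auto
    then have "vec (dual c) B = (0 :: 'k)" if "c \<in> S" for c
      using that by (simp add: supp_def)
    then have "y B = 0" unfolding y_def by (intro sum.neutral) auto
    with that show False by (simp add: supp_def)
  qed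
  have yG: "pair y (val c) = G c" if c: "wfc c" for c
  proof -
    have "pair y (val c) = (\<Sum>c'\<in>S. if c' = c then G c' else 0)"
      unfolding py using c by (intro sum.cong) (auto simp: S_def lev_dual)
    also have "\<dots> = G c" using S G0[OF c] by auto
    finally show ?thesis .
  qed
  have fdy: "fvec (bar_d y)" by (rule fvec_bar_d[OF fy])
  have "pair (x - bar_d y) (val c) = 0" if c: "wfc c" for c
  proof -
    have "pair (bar_d y) (val c) = lev (\<lambda>e. pair y (val e)) (expand c)"
      using pair_d[OF fy] wy by blast
    also have "\<dots> = lev G (expand c)"
      using c expand_invariants by (intro lev_cong yG) blast
    also have "\<dots> = F c"
    proof (cases "reducible c")
      case True
      \<comment> \<open>The second summand of the homotopy identity vanishes since \<open>x\<close>
        is a cycle.\<close>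
      have "lev (\<lambda>e. lev F (expand e)) (contract c) = 0"
        using c contract_invariants by (intro lev_eq_0 dF) blast
      then show ?thesis
        using homotopy[OF c True, of F] by (simp add: G_def[abs_def])
    next
      case False
      \<comment> \<open>An irreducible cell lies on the diagonal, whereas \<open>x\<close> has k <
        w.\<close>
      then have "F c = 0"
        using irreducible_cnodes[OF False] kw by (intro F0) auto
      then show ?thesis using irreducible_expand[OF False] by simp
    qed
    finally show ?thesis
      using pair_diff[OF fx fdy, of "val c"] by (simp add: F_def)
  qed
  moreover have "wfb2 B" if B: "B \<in> supp (x - bar_d y)" for B
  proof -
    consider "B \<in> supp x" | "B \<in> supp (bar_d y)"
      using subsetD[OF supp_diff B] by blast
    then show ?thesis
    proof cases
      case 2
      then obtain B' s where "B' \<in> supp y" "(s, B) \<in> set (dl B')"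
        using subsetD[OF supp_bar_d 2] by auto
      then show ?thesis using wfb_dl(1) wy by blast
    qed (use wx in blast)
  qed
  ultimately have "x - bar_d y \<in> brel"
    using fvec_diff[OF fx fdy] by (intro bar_rel_if_vals_0) auto
  moreover have "bar_chain gens two (Suc k) w y"
    using fy wy by (simp add: bar_chain_def)
  ultimately show "\<exists>y. bar_chain gens two (Suc k) w y \<and> x - bar_d y \<in> brel"
    by blast
qed

section \<open>No quadratic Groebner basis\<close>

text \<open>The powers of \<open>m\<close> at the first input. Unlike the single monomial mmm, this
  class is closed under divisors, which suits an induction on \<open>divides\<close>.\<close>

primrec left_comb :: "nat \<Rightarrow> tree \<Rightarrow> bool" and left_combs :: "nat \<Rightarrow> tree list \<Rightarrow> bool" where
  "left_comb m Leaf \<longleftrightarrow> True"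
| "left_comb m (Node g ts) \<longleftrightarrow> g = m \<and> left_combs m ts \<and> (\<forall>t\<in>set (tl ts). t = Leaf)"
| "left_combs m [] \<longleftrightarrow> True"
| "left_combs m (t # ts) \<longleftrightarrow> left_comb m t \<and> left_combs m ts"

lemma subst_eq_Leaf: "subst t us = Leaf \<Longrightarrow> t = Leaf"
  by (cases t) auto

lemma substs_eq_Leaf: "\<forall>t\<in>set (substs ts us). t = Leaf \<Longrightarrow> \<forall>t\<in>set ts. t = Leaf"
  by (induction ts arbitrary: us) (auto dest: subst_eq_Leaf)

lemma tl_substs_eq_Leaf: "\<forall>t\<in>set (tl (substs ts us)). t = Leaf \<Longrightarrow> \<forall>t\<in>set (tl ts). t = Leaf"
  by (cases ts) (auto dest: substs_eq_Leaf)

lemma left_comb_outer: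
  "left_comb m (subst t us) \<Longrightarrow> left_comb m t"
  "left_combs m (substs ts us) \<Longrightarrow> left_combs m ts"
proof (induction t and ts arbitrary: us and us rule: tree_list_induct)
  case (Node g ts)
  then show ?case using tl_substs_eq_Leaf[of ts us] by auto
qed auto

lemma left_comb_inner:
  "left_comb m (subst t us) \<Longrightarrow> length us = leaves t \<Longrightarrow> u \<in> set us \<Longrightarrow> left_comb m u"
  "left_combs m (substs ts us) \<Longrightarrow> length us = leavess ts \<Longrightarrow> u \<in> set us \<Longrightarrow> left_comb m u"
proof (induction t and ts arbitrary: us and us rule: tree_list_induct)
  case (Cons t ts)
  from Cons.prems(3) have "u \<in> set (take (leaves t) us) \<or> u \<in> set (drop (leaves t) us)"
    by (metis Un_iff append_take_drop_id set_append)
  then show ?case using Cons by auto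
qed (auto simp: length_Suc_conv)

text \<open>Both the outer and the inner factor of a composition inherit the property. Hence mm is
  the only divisor of mmm of weight 2.\<close>

lemma divides_left_comb: "divides Gs ar s t \<Longrightarrow> left_comb m t \<Longrightarrow> left_comb m s"
proof (induction rule: divides.induct)
  case (left s t u i)
  have "left_comb m t"
    by (rule left_comb_inner(1)[OF left.prems[unfolded comp_def]]) (use left in auto)
  then show ?case by (rule left.IH)
next
  case (right s t u i)
  then show ?case using left_comb_outer unfolding comp_def by blast
qed

lemma left_comb_weight_2:
  assumes "left_comb m s" "wft gens two s" "weight s = 2"
  shows "s = comb m m"
  using assms(2,3)
proof (cases rule: weight_2_cases)
qed (use assms in auto)

lemma least_generator:
  assumes "monomial_order gens two lt"
  shows "\<exists>m\<in>gens. \<forall>g\<in>gens. g \<noteq> m \<longrightarrow> lt (corolla m) (corolla g)"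
proof -
  have wf: "wft gens two (corolla g)" if "g \<in> gens" for g
    using that by simp
  have total: "lt (corolla g) (corolla h) \<or> lt (corolla h) (corolla g)" if "g \<in> gens" "h \<in> gens" "g \<noteq> h" for g h
    using assms that unfolding monomial_order_def by simp
  have trans: "lt (corolla g) (corolla k)"
    if "g \<in> gens" "h \<in> gens" "k \<in> gens" "lt (corolla g) (corolla h)" "lt (corolla h) (corolla k)" for g h k
    using assms wf[OF that(1)] wf[OF that(2)] wf[OF that(3)] that(4,5) unfolding monomial_order_def by blast
  have "lt (corolla 0) (corolla 1) \<or> lt (corolla 1) (corolla 0)"
    "lt (corolla 0) (corolla 2) \<or> lt (corolla 2) (corolla 0)"
    "lt (corolla 1) (corolla 2) \<or> lt (corolla 2) (corolla 1)"
    by (rule total; simp)+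
  then show ?thesis
    using trans[of 0 1 2] trans[of 0 2 1] trans[of 1 0 2] trans[of 1 2 0] trans[of 2 0 1] trans[of 2 1 0]
    unfolding gens_def by auto
qed

lemma comb_eq_comp: "comb p c = comp (corolla p) 0 (corolla c)"
  by (simp add: comp_def)

text \<open>mm is compared with pm by exchanging the outer factor, and pm with pc by exchanging the
  inner one.\<close>

lemma least_comb:
  assumes ord: "monomial_order gens two lt" and m: "m \<in> gens"
    "\<And>g. g \<in> gens \<Longrightarrow> g \<noteq> m \<Longrightarrow> lt (corolla m) (corolla g)"
    and pc: "p \<in> gens" "c \<in> gens" "comb p c \<noteq> comb m m"
  shows "lt (comb m m) (comb p c)"
proof -
  have 1: "lt (comb m m) (comb p m)" if "p \<noteq> m"
  proof -
    have "lt (comp s i t) (comp s' i t)"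
      if "wft gens two s" "wft gens two s'" "wft gens two t" "leaves s = leaves s'" "i < leaves s" "lt s s'"
      for s s' t i
      using ord that unfolding monomial_order_def by blast
    then show ?thesis
      unfolding comb_eq_comp using m pc that by simp
  qed
  have 2: "lt (comb p m) (comb p c)" if "c \<noteq> m"
  proof -
    have "lt (comp t i s) (comp t i s')"
      if "wft gens two s" "wft gens two s'" "wft gens two t" "leaves s = leaves s'" "i < leaves t" "lt s s'"
      for s s' t i
      using ord that unfolding monomial_order_def by blast
    then show ?thesis
      unfolding comb_eq_comp using m pc that by simp
  qed
  have "wft gens two (comb m m)" "wft gens two (comb p m)" "wft gens two (comb p c)"
    using m(1) pc by auto
  then have 3: "lt (comb m m) (comb p m) \<Longrightarrow> lt (comb p m) (comb p c) \<Longrightarrow> lt (comb m m) (comb p c)"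
    using ord unfolding monomial_order_def by blast
  show ?thesis using 1 2 3 pc(3) by (cases "p = m"; cases "c = m") auto
qed

lemma not_groebner:
  assumes ord: "monomial_order gens two lt"
  shows "\<not> groebner_basis gens two lt (rels :: (tree \<Rightarrow> 'k::field) set)"
proof
  assume gb: "groebner_basis gens two lt (rels :: (tree \<Rightarrow> 'k) set)"
  obtain m where m: "m \<in> gens" "\<And>g. g \<in> gens \<Longrightarrow> g \<noteq> m \<Longrightarrow> lt (corolla m) (corolla g)"
    using least_generator[OF ord] by blast
  define T where "T = Node m [comb m m, Leaf]"
  have "bvec T \<in> (ideal :: (tree \<Rightarrow> 'k) set)" unfolding T_def by (intro ideal_left_comb m)
  moreover have "bvec T \<noteq> (0 :: tree \<Rightarrow> 'k)" by (auto simp: bvec_def fun_eq_iff)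
  moreover have "arity_homog (bvec T :: tree \<Rightarrow> 'k)" by (auto simp: arity_homog_def)
  ultimately obtain t r s where *: "is_lm lt (bvec T :: tree \<Rightarrow> 'k) t"
      "r \<in> (rels :: (tree \<Rightarrow> 'k) set)" "is_lm lt r s" "divides gens two s t"
    using gb unfolding groebner_basis_def by blast
  have "t = T" using *(1) by (simp add: is_lm_def)
  have r: "fvec r" "wft gens two u \<and> weight u = 2" if "u \<in> supp r" for u
    using *(2) that by (auto simp: rels_def free_vec_def)
  have s: "s \<in> supp r" "\<And>u. u \<in> supp r \<Longrightarrow> u \<noteq> s \<Longrightarrow> lt u s"
    using *(3) by (auto simp: is_lm_def)
  have "left_comb m T" by (simp add: T_def)
  then have smm: "s = comb m m"
    using divides_left_comb[OF *(4)] \<open>t = T\<close> r(2)[OF s(1)] by (intro left_comb_weight_2) auto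
  \<comment> \<open>Another comb in \<open>r\<close> would exceed mm, contrary to mm being leading.
    Monomials with a nontrivial second child may well be smaller than mm, but the form vanishes on
    them.\<close>
  have zero: "prod_form i u = (0 :: 'k)" if u: "u \<in> supp r" "u \<noteq> s" for u i
    using r(2)[OF u(1), THEN conjunct1] r(2)[OF u(1), THEN conjunct2]
  proof (cases rule: weight_2_cases)
    case (1 p c)
    then have "lt s u" using least_comb[OF ord m] u(2) smm by auto
    with s(2)[OF u] have "lt s s"
      using ord r(2)[OF u(1)] r(2)[OF s(1)] unfolding monomial_order_def by blast
    then show ?thesis using ord r(2)[OF s(1)] unfolding monomial_order_def by blast
  qed auto
  \<comment> \<open>Generator 1 is w + k_2 without a k_1-part; generators 0 and 2 have
    k_1-coordinate 1. This expresses that mm is nonzero in the operad.\<close>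
  have "coord (if m = 1 then 2 else 1) m = (1 :: 'k)"
    using m(1) by (auto simp: gens_def coord_def)
  then obtain i where i: "i \<in> {1, 2}" "coord i m = (1 :: 'k)"
    by (metis insertI1 insertI2)
  \<comment> \<open>Only the leading monomial contributes, so the defining condition of
    \<open>rels\<close> forces its coefficient to vanish.\<close>
  have "pair r (prod_form i) = (\<Sum>u\<in>{s}. r u * prod_form i u)"
    unfolding pair_def using r(1)[OF s(1)] s(1) zero
    by (intro sum.mono_neutral_right) (auto simp: fvec_def)
  also have "\<dots> = r s" using smm i by simp
  finally show False using *(2) i(1) s(1) by (auto simp: rels_def supp_def)
qed

theorem theorem4p2:
  "\<exists>(Gs :: nat set) (ar :: nat \<Rightarrow> nat) (R :: (tree \<Rightarrow> 'k::field) set).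
     quadratic_presentation Gs ar R \<and> koszul Gs ar R \<and>
     \<not> (\<exists>lt. monomial_order Gs ar lt \<and> groebner_basis Gs ar lt R)"
  using quadratic_presentation_rels koszul_rels not_groebner by blast

end
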